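(* Let $P\subset\mathbb{R}^n$ be an $n$-dimensional integral polytope. Suppose $\mathrm{Vol}(P)\ge(n+2)(n+1)$. Then the double cone $D(P)\subset\mathbb{R}^{n+1}$ is not asymptotically Chow semistable.
   Context: The double cone of an integral polytope $P\subset\mathbb{R}^n$ is $D(P)=\mathrm{conv}\big(\{(0,\dots,0,1),(0,\dots,0,-1)\}\cup\{(p,0):p\in P\}\big)\subset\mathbb{R}^{n+1}$. Chow stability: let $Q\subset\mathbb{R}^d$ be a $d$-dimensional integral convex polytope, and let $G$ be the largest (finite) subgroup of $SL(d,\mathbb{Z})$ preserving $Q$. Write $\chi(kQ)=\#(kQ\cap\mathbb{Z}^d)$ and let $\mathrm{Vol}$, $dV$ be Lebesgue measure. $Q$ (or the polarized toric variety $X_Q$) is asymptotically Chow semistable if there is a constant $C$ such that for all integers $k\ge C$ and all $G$-invariant convex functions $f:kQ\to\mathbb{R}$, $$\frac{1}{\mathrm{Vol}(kQ)}\int_{kQ}f\,dV\le\frac{1}{\chi(kQ)}\sum_{p\in kQ\cap\mathbb{Z}^d}f(p).$$ *)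

theory Defs
  imports "HOL-Analysis.Analysis"
begin

definition integer_points :: "(real ^ 'd) set" where
  "integer_points = {x. \<forall>i. x $ i \<in> \<int>}"

definition integral_polytope :: "(real ^ 'd) set \<Rightarrow> bool" where
  "integral_polytope Q \<longleftrightarrow> (\<exists>V. finite V \<and> V \<subseteq> integer_points \<and> Q = convex hull V)"

definition dilate :: "nat \<Rightarrow> (real ^ 'd) set \<Rightarrow> (real ^ 'd) set" where
  "dilate k Q = (\<lambda>x. real k *\<^sub>R x) ` Q"

definition Vol :: "(real ^ 'd) set \<Rightarrow> real" where
  "Vol Q = measure lebesgue Q"

definition lattice_count :: "(real ^ 'd) set \<Rightarrow> nat" where
  "lattice_count Q = card (Q \<inter> integer_points)"

definition SL_int :: "(real ^ 'd ^ 'd) set" where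
  "SL_int = {A. (\<forall>i j. A $ i $ j \<in> \<int>) \<and> det A = 1}"

text \<open>The largest subgroup of SL(d,Z) preserving Q is the full (linear) stabilizer of Q. It is
  finite when Q is a full-dimensional polytope.\<close>

definition sym_group :: "(real ^ 'd) set \<Rightarrow> (real ^ 'd ^ 'd) set" where
  "sym_group Q = {A \<in> SL_int. (\<lambda>x. A *v x) ` Q = Q}"

definition group_invariant_on ::
    "(real ^ 'd ^ 'd) set \<Rightarrow> (real ^ 'd) set \<Rightarrow> (real ^ 'd \<Rightarrow> real) \<Rightarrow> bool" where
  "group_invariant_on G S f \<longleftrightarrow> (\<forall>A\<in>G. \<forall>x\<in>S. f (A *v x) = f x)"

text \<open>Intended for full-dimensional integral polytopes Q; by the last two lemmas of this theory
  the double cone of such a polytope is again one. A function on kQ is represented by a total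
  function, of which only the values on kQ matter; being convex on a polytope, it is bounded and
  almost everywhere continuous there, so the Lebesgue integral exists.\<close>

definition asymptotically_Chow_semistable :: "(real ^ 'd) set \<Rightarrow> bool" where
  "asymptotically_Chow_semistable Q \<longleftrightarrow>
    (\<exists>C::nat. \<forall>k\<ge>C. \<forall>f :: real ^ 'd \<Rightarrow> real.
      convex_on (dilate k Q) f \<longrightarrow> group_invariant_on (sym_group Q) (dilate k Q) f \<longrightarrow>
      1 / Vol (dilate k Q) * (LINT x:dilate k Q|lebesgue. f x)
        \<le> 1 / real (lattice_count (dilate k Q)) * (\<Sum>p\<in>dilate k Q \<inter> integer_points. f p))"

text \<open>The space of dimension n+1 is indexed by the option type over the index type of the
  n-dimensional space; None is the additional, last coordinate, so that \<open>append_coord p t\<close>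
  is the point (p, t).\<close>

definition append_coord :: "real ^ 'n \<Rightarrow> real \<Rightarrow> real ^ ('n option)" where
  "append_coord p t = (\<chi> i. case i of None \<Rightarrow> t | Some j \<Rightarrow> p $ j)"

definition double_cone :: "(real ^ 'n) set \<Rightarrow> (real ^ ('n option)) set" where
  "double_cone P =
    convex hull ({append_coord 0 1, append_coord 0 (-1)} \<union> {append_coord p 0 | p. p \<in> P})"

lemma append_coord_nth [simp]:
  "append_coord p t $ None = t" "append_coord p t $ Some j = p $ j"
  by (simp_all add: append_coord_def)

lemma linear_append_coord: "linear (\<lambda>p. append_coord p 0)"
  by (rule linearI) (simp_all add: append_coord_def vec_eq_iff split: option.split)

lemma inj_append_coord: "inj (\<lambda>p. append_coord p t)"
  by (rule injI) (metis append_coord_nth(2) vec_eq_iff)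

lemma integral_polytope_double_cone:
  assumes "integral_polytope P"
  shows "integral_polytope (double_cone P)"
proof -
  from assms obtain V where V: "finite V" "V \<subseteq> integer_points" "P = convex hull V"
    unfolding integral_polytope_def by blast
  let ?f = "\<lambda>p. append_coord p 0" and ?E = "{append_coord 0 1, append_coord 0 (-1)}"
  have "{?f p | p. p \<in> P} = ?f ` P" by blast
  also have "\<dots> = convex hull (?f ` V)"
    using V(3) convex_hull_linear_image[OF linear_append_coord] by metis
  finally have "double_cone P = convex hull (?E \<union> convex hull (?f ` V))"
    unfolding double_cone_def by simp
  also have "\<dots> = convex hull (?E \<union> ?f ` V)"
    by (rule hull_Un_right[symmetric])
  finally have eq: "double_cone P = convex hull (?E \<union> ?f ` V)" .
  have "?E \<union> ?f ` V \<subseteq> integer_points"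
    using V(2) by (auto simp: integer_points_def append_coord_def subset_iff split: option.split)
  moreover have "finite (?E \<union> ?f ` V)" using V(1) by simp
  ultimately show ?thesis unfolding integral_polytope_def using eq by blast
qed

lemma aff_dim_double_cone:
  fixes P :: "(real ^ 'n) set"
  assumes "aff_dim P = int CARD('n)"
  shows "aff_dim (double_cone P) = int CARD('n option)"
proof -
  let ?f = "\<lambda>p::real^'n. append_coord p 0" and ?e = "append_coord (0::real^'n) 1"
  let ?S = "?f ` P"
  have dimS: "aff_dim ?S = int CARD('n)"
    using aff_dim_injective_linear_image[OF linear_append_coord inj_append_coord] assms by metis
  let ?H = "{x::real^('n option). axis None 1 \<bullet> x = 0}"
  have "affine hull ?S \<subseteq> ?H"
  proof (rule hull_minimal)
    show "?S \<subseteq> ?H" by (auto simp: inner_axis')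
    show "affine ?H" by (rule affine_hyperplane)
  qed
  moreover have "?e \<notin> ?H" by (simp add: inner_axis')
  ultimately have "?e \<notin> affine hull ?S" by blast
  then have "aff_dim (insert ?e ?S) = int CARD('n) + 1"
    using dimS by (simp add: aff_dim_insert)
  moreover have "insert ?e ?S \<subseteq> double_cone P"
    unfolding double_cone_def by (rule subset_trans[OF _ hull_subset]) auto
  then have "aff_dim (insert ?e ?S) \<le> aff_dim (double_cone P)"
    by (rule aff_dim_subset)
  moreover have "aff_dim (double_cone P) \<le> int CARD('n option)"
    using aff_dim_le_DIM[of "double_cone P"] by simp
  moreover have "CARD('n option) = CARD('n) + 1" by simp
  ultimately show ?thesis by linarith
qed

end

theory Submission
  imports Defs
begin

text \<open>
  Write \<open>P0\<close> for the convex hull of \<open>P\<close> and the origin, \<open>n\<close> for the dimension, \<open>v\<close> for the volume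
  of \<open>P0\<close>, \<open>b j\<close> for the number of lattice points of \<open>j P0\<close> and \<open>D\<close> for the double cone. The slice of
  \<open>k D\<close> at height \<open>t\<close> is \<open>(k - |t|) P0\<close>. Hence \<open>k D\<close> has volume \<open>W k = 2 v k^(n+1) / (n+1)\<close> and
  contains \<open>N k = b k + 2 (b 0 + ... + b (k-1))\<close> lattice points.

  The functions that destabilise \<open>D\<close> are the caps \<open>f x = max 0 (|t| - (k - m))\<close>, where \<open>t\<close> is the
  height of \<open>x\<close>; they live within distance \<open>m\<close> of the two apexes. The integral of such a cap over
  \<open>k D\<close> is \<open>I m = 2 v m^(n+2) / ((n+1) (n+2))\<close>, its sum over the lattice points is
  \<open>S m = 2 (m b 0 + (m-1) b 1 + ... + b (m-1))\<close>, and neither depends on \<open>k\<close>. A cap need not be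
  invariant under the symmetry group of \<open>D\<close>, but this group is finite and preserves Lebesgue measure
  and the lattice, so averaging over the group carries the stability inequality over to every convex
  function (lemma \<open>semistable_without_invariance\<close>). Semistability thus gives
  \<open>N k * I m \<le> W k * S m\<close> for all large \<open>k\<close> and all \<open>1 \<le> m \<le> k\<close>.

  For \<open>m = 1\<close> the sum \<open>S 1 = 2\<close> only sees the two apexes, whereas \<open>I 1 \<ge> 2\<close> by the volume hypothesis,
  so \<open>N k \<le> W k\<close> for all large \<open>k\<close>. This contradicts the positivity of the second Ehrhart
  coefficient of \<open>D\<close>; the other caps lead to a contradiction without Ehrhart theory.
  As \<open>k\<close> tends to infinity, \<open>N k / W k\<close> tends to \<open>1\<close>, so \<open>I m \<le> S m\<close> for every \<open>m\<close>. On the other hand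
  \<open>S m = N 0 + ... + N (m-1) + (N m - b m) / 2\<close>. Bounding \<open>N\<close> by \<open>W\<close> here turns the right-hand side
  into the trapezoidal approximation of \<open>I m\<close>, the integral of \<open>W\<close> from \<open>0\<close> to \<open>m\<close>, minus \<open>b m / 2\<close>,
  up to a constant. The trapezoidal error is at most \<open>v m^n / 4\<close>, so \<open>b m \<le> v m^n / 2\<close> up to a constant.
  This is absurd because \<open>b m\<close> is asymptotic to \<open>v m^n\<close>. This numerical argument is lemma
  \<open>cap_inequalities_contradictory\<close>.
\<close>

section \<open>The trapezoidal rule and the numerical contradiction\<close>

text \<open>The second-order Taylor polynomials of \<open>x ^ (n + 2)\<close> bound the value at the midpoint of an
  interval from below at the left end point and from above at the right end point, because the third
  derivative is nonnegative.\<close>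
lemma power_add_half_lower:
  fixes a :: real
  assumes "a \<ge> 0"
  shows "a ^ (n + 2) + real (n + 2) / 2 * a ^ (n + 1) + real (n + 2) * real (n + 1) / 8 * a ^ n
    \<le> (a + 1 / 2) ^ (n + 2)"
proof (induction n)
  case 0
  then show ?case by (simp add: power2_eq_square field_simps)
next
  case (Suc n)
  have "(a + 1 / 2) ^ (Suc n + 2) = (a + 1 / 2) * (a + 1 / 2) ^ (n + 2)" by simp
  also have "\<dots> \<ge> (a + 1 / 2) * (a ^ (n + 2) + real (n + 2) / 2 * a ^ (n + 1)
      + real (n + 2) * real (n + 1) / 8 * a ^ n)"
    using Suc assms by (intro mult_left_mono) auto
  moreover have "(a + 1 / 2) * (a ^ (n + 2) + real (n + 2) / 2 * a ^ (n + 1)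
      + real (n + 2) * real (n + 1) / 8 * a ^ n)
     = a ^ (Suc n + 2) + real (Suc n + 2) / 2 * a ^ (Suc n + 1)
        + real (Suc n + 2) * real (Suc n + 1) / 8 * a ^ Suc n
        + real (n + 2) * real (n + 1) / 16 * a ^ n"
    by (simp add: field_simps)
  moreover have "real (n + 2) * real (n + 1) / 16 * a ^ n \<ge> 0"
    using assms by simp
  ultimately show ?case by linarith
qed

lemma power_diff_half_upper:
  fixes b :: real
  assumes "b \<ge> 1 / 2"
  shows "(b - 1 / 2) ^ (n + 2)
    \<le> b ^ (n + 2) - real (n + 2) / 2 * b ^ (n + 1) + real (n + 2) * real (n + 1) / 8 * b ^ n"
proof (induction n)
  case 0
  then show ?case by (simp add: power2_eq_square field_simps)
next
  case (Suc n)
  have "(b - 1 / 2) ^ (Suc n + 2) = (b - 1 / 2) * (b - 1 / 2) ^ (n + 2)" by simp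
  also have "\<dots> \<le> (b - 1 / 2) * (b ^ (n + 2) - real (n + 2) / 2 * b ^ (n + 1)
      + real (n + 2) * real (n + 1) / 8 * b ^ n)"
    using Suc assms by (intro mult_left_mono) auto
  moreover have "(b - 1 / 2) * (b ^ (n + 2) - real (n + 2) / 2 * b ^ (n + 1)
      + real (n + 2) * real (n + 1) / 8 * b ^ n)
     = b ^ (Suc n + 2) - real (Suc n + 2) / 2 * b ^ (Suc n + 1)
        + real (Suc n + 2) * real (Suc n + 1) / 8 * b ^ Suc n
        - real (n + 2) * real (n + 1) / 16 * b ^ n"
    by (simp add: field_simps)
  moreover have "real (n + 2) * real (n + 1) / 16 * b ^ n \<ge> 0"
    using assms by simp
  ultimately show ?case by linarith
qed

text \<open>On the interval from \<open>i\<close> to \<open>i + 1\<close> the two Taylor bounds, read for the antiderivative of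
  \<open>g x = x ^ (n + 1)\<close>, say that the trapezoidal rule overestimates the integral of \<open>g\<close> by at most
  \<open>(g' (i + 1) - g' i) / 8\<close>. These errors telescope. The optimal constant would be \<open>1 / 12\<close>, but any
  constant below \<open>1 / 4\<close> serves in the comparison with the lattice point count below.\<close>
lemma trapezoid_sum_power_le:
  "(\<Sum>i<m. real i ^ (n + 1)) + real m ^ (n + 1) / 2
     \<le> real m ^ (n + 2) / real (n + 2) + real (n + 1) * real m ^ n / 8"
proof (induction m)
  case 0
  then show ?case by simp
next
  case (Suc m)
  let ?a = "real m" and ?b = "real (Suc m)"
  have "?a ^ (n + 2) + real (n + 2) / 2 * ?a ^ (n + 1) + real (n + 2) * real (n + 1) / 8 * ?a ^ n
      \<le> (?a + 1 / 2) ^ (n + 2)"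
    by (rule power_add_half_lower) simp
  also have "?a + 1 / 2 = ?b - 1 / 2" by simp
  also have "(?b - 1 / 2) ^ (n + 2) \<le> ?b ^ (n + 2) - real (n + 2) / 2 * ?b ^ (n + 1)
      + real (n + 2) * real (n + 1) / 8 * ?b ^ n"
    by (rule power_diff_half_upper) simp
  finally have "(?a ^ (n + 2) + real (n + 2) / 2 * ?a ^ (n + 1)
        + real (n + 2) * real (n + 1) / 8 * ?a ^ n) / real (n + 2)
      \<le> (?b ^ (n + 2) - real (n + 2) / 2 * ?b ^ (n + 1)
        + real (n + 2) * real (n + 1) / 8 * ?b ^ n) / real (n + 2)"
    by (rule divide_right_mono) simp
  moreover have "(x + r / 2 * y + r * s / 8 * z) / r = x / r + y / 2 + s * z / 8"
    if "r \<noteq> 0" for r s x y z :: real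
    using that by (simp add: field_simps)
  moreover have "(x - r / 2 * y + r * s / 8 * z) / r = x / r - y / 2 + s * z / 8"
    if "r \<noteq> 0" for r s x y z :: real
    using that by (simp add: field_simps)
  ultimately have "?a ^ (n + 2) / real (n + 2) + ?a ^ (n + 1) / 2 + real (n + 1) * ?a ^ n / 8
      \<le> ?b ^ (n + 2) / real (n + 2) - ?b ^ (n + 1) / 2 + real (n + 1) * ?b ^ n / 8"
    by simp
  with Suc show ?case by simp
qed

text \<open>The numerical core. Here \<open>b j\<close> is the number of lattice points of the \<open>j\<close>-th dilate of the base,
  \<open>N k\<close> and \<open>W k\<close> are the lattice point count and the volume of the \<open>k\<close>-th dilate of the double cone,
  and the last hypothesis is the stability inequality for the caps. The asymptotic lower bounds on \<open>b\<close>
  and \<open>N\<close> hold for every convex body, see \<open>lattice_count_dilate_eventually_ge\<close>.\<close>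
lemma cap_inequalities_contradictory:
  fixes b N W :: "nat \<Rightarrow> real" and v :: real and n C :: nat
  defines "N \<equiv> \<lambda>k. b k + 2 * (\<Sum>j<k. b j)"
    and "W \<equiv> \<lambda>k. 2 * v * real k ^ (n + 1) / real (n + 1)"
  assumes n: "n \<ge> 1" and v: "v \<ge> real (n + 2) * real (n + 1)"
    and b0: "b 0 = 1" and b_nonneg: "\<And>j. b j \<ge> 0"
    and b_lower: "\<And>s. s < 1 \<Longrightarrow> \<forall>\<^sub>F k in sequentially. s * (v * real k ^ n) \<le> b k"
    and N_lower: "\<And>s. s < 1 \<Longrightarrow> \<forall>\<^sub>F k in sequentially. s * W k \<le> N k"
    and ineq: "\<And>k m. k \<ge> C \<Longrightarrow> 1 \<le> m \<Longrightarrow> m \<le> k \<Longrightarrow>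
      N k * (2 * v * real m ^ (n + 2) / (real (n + 1) * real (n + 2)))
        \<le> W k * (2 * (\<Sum>j<m. real (m - j) * b j))"
  shows False
proof -
  define I where "I m = 2 * v * real m ^ (n + 2) / (real (n + 1) * real (n + 2))" for m
  define S where "S m = 2 * (\<Sum>j<m. real (m - j) * b j)" for m
  have v1: "v \<ge> 1"
  proof -
    have "1 * 1 \<le> real (n + 2) * real (n + 1)" by (rule mult_mono) auto
    with v show ?thesis by linarith
  qed
  have W_pos: "W k > 0" if "k \<ge> 1" for k using that v1 unfolding W_def by simp
  have W_nonneg: "W k \<ge> 0" for k using v1 unfolding W_def by simp
  have N_nonneg: "N k \<ge> 0" for k unfolding N_def by (simp add: b_nonneg sum_nonneg)
  \<comment> \<open>The cap of depth one sees only the two apexes.\<close>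
  have N_le_W: "N k \<le> W k" if k: "k \<ge> max C 1" for k
  proof -
    have "real (n + 1) * real (n + 2) > 0" by simp
    then have "I 1 \<ge> 2" using v unfolding I_def by (simp add: pos_le_divide_eq algebra_simps del: of_nat_mult)
    then have "N k * 2 \<le> N k * I 1" by (rule mult_left_mono) (rule N_nonneg)
    also have "\<dots> \<le> W k * 2" using ineq[of k 1] k b0 unfolding I_def by simp
    finally show ?thesis by simp
  qed
  \<comment> \<open>The inequality for a fixed depth \<open>m\<close> in the limit of large \<open>k\<close>, where \<open>N k / W k\<close> is at least
    every \<open>s < 1\<close>.\<close>
  have I_le_S: "I m \<le> S m" if m: "m \<ge> 1" for m
  proof (rule field_le_mult_one_interval)
    fix s :: real assume s: "0 < s" "s < 1"
    have "\<forall>\<^sub>F k in sequentially. s * W k \<le> N k \<and> k \<ge> max C m"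
      using N_lower[OF s(2)] eventually_ge_at_top by (rule eventually_conj)
    then obtain k where k: "s * W k \<le> N k" "k \<ge> max C m"
      using eventually_happens'[OF sequentially_bot] by blast
    have "I m \<ge> 0" using v1 unfolding I_def by simp
    then have "(s * W k) * I m \<le> N k * I m" using k by (intro mult_right_mono) auto
    also have "\<dots> \<le> W k * S m" using ineq[of k m] k m unfolding I_def S_def by auto
    finally have "W k * (s * I m) \<le> W k * S m" by (simp add: mult_ac)
    then show "s * I m \<le> S m" using W_pos[of k] k m by (simp add: mult_le_cancel_left)
  qed
  \<comment> \<open>Both sides increase by \<open>N m + b m\<close>, twice the sum of \<open>b\<close> up to \<open>m\<close>. The term \<open>- b m / 2\<close> is
    what finally beats the trapezoidal error.\<close>
  have S_eq: "S m = (\<Sum>i<m. N i) + (N m - b m) / 2" for m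
  proof (induction m)
    case (Suc m)
    have "(\<Sum>j<Suc m. real (Suc m - j) * b j) = (\<Sum>j<m. real (Suc m - j) * b j) + b m" by simp
    also have "(\<Sum>j<m. real (Suc m - j) * b j) = (\<Sum>j<m. real (m - j) * b j + b j)"
      by (rule sum.cong) (auto simp: Suc_diff_le of_nat_Suc algebra_simps)
    also have "\<dots> = (\<Sum>j<m. real (m - j) * b j) + (\<Sum>j<m. b j)" by (rule sum.distrib)
    finally show ?case using Suc unfolding S_def N_def by simp
  qed (simp add: S_def N_def)
  \<comment> \<open>The finitely many indices where \<open>N\<close> may exceed \<open>W\<close>.\<close>
  define K where "K = (\<Sum>i<max C 1. N i)"
  define c where "c = 2 * v / real (n + 1)"
  have W_c: "W i = c * real i ^ (n + 1)" for i unfolding W_def c_def by simp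
  have b_upper: "b m \<le> 2 * K + v * real m ^ n / 2" if m: "m \<ge> max C 1" for m
  proof -
    have "(\<Sum>i<m. N i) = K + (\<Sum>i\<in>{max C 1..<m}. N i)"
      unfolding K_def using m by (simp add: lessThan_atLeast0 sum.atLeastLessThan_concat)
    also have "(\<Sum>i\<in>{max C 1..<m}. N i) \<le> (\<Sum>i\<in>{max C 1..<m}. W i)"
      by (rule sum_mono) (use N_le_W in auto)
    also have "\<dots> \<le> (\<Sum>i<m. W i)"
      by (rule sum_mono2) (auto simp: W_nonneg)
    finally have "(\<Sum>i<m. N i) \<le> K + (\<Sum>i<m. W i)" by simp
    moreover have "I m \<le> (\<Sum>i<m. N i) + (N m - b m) / 2" using I_le_S[of m] S_eq[of m] m by simp
    moreover have "(N m - b m) / 2 \<le> (W m - b m) / 2" using N_le_W[OF m] by simp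
    ultimately have "I m \<le> K + (\<Sum>i<m. W i) + (W m - b m) / 2" by linarith
    also have "\<dots> = K + c * ((\<Sum>i<m. real i ^ (n + 1)) + real m ^ (n + 1) / 2) - b m / 2"
      unfolding W_c by (simp add: distrib_left sum_distrib_left diff_divide_distrib)
    also have "\<dots> \<le> K + c * (real m ^ (n + 2) / real (n + 2) + real (n + 1) * real m ^ n / 8) - b m / 2"
      using mult_left_mono[OF trapezoid_sum_power_le[of n m], of c] v1 by (simp add: c_def)
    also have "c * (real m ^ (n + 2) / real (n + 2) + real (n + 1) * real m ^ n / 8)
        = I m + v * real m ^ n / 4"
      unfolding I_def c_def distrib_left by (simp del: of_nat_Suc of_nat_add)
    finally show ?thesis by simp
  qed
  have "\<forall>\<^sub>F m in sequentially. 3 / 4 * (v * real m ^ n) \<le> b m \<and> m \<ge> max (max C 1) (nat \<lceil>8 * K\<rceil> + 1)"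
    by (rule eventually_conj[OF b_lower eventually_ge_at_top]) simp
  then obtain m where m: "3 / 4 * (v * real m ^ n) \<le> b m" "m \<ge> max C 1" "m \<ge> nat \<lceil>8 * K\<rceil> + 1"
    using eventually_happens'[OF sequentially_bot] by fastforce
  have "real m \<le> real m ^ n" using n m(2) self_le_power[of "real m" n] by simp
  also have "\<dots> \<le> v * real m ^ n" using mult_right_mono[OF v1, of "real m ^ n"] by simp
  also have "\<dots> \<le> 8 * K" using m(1) b_upper[OF m(2)] by simp
  also have "\<dots> < real m" using m(3) by linarith
  finally show False by simp
qed

section \<open>Lebesgue measure, linear symmetries and slices\<close>

lemma nn_integral_lborel_translation:
  fixes f :: "'a::euclidean_space \<Rightarrow> ennreal"
  assumes [measurable]: "f \<in> borel_measurable borel"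
  shows "(\<integral>\<^sup>+x. f (c + x) \<partial>lborel) = (\<integral>\<^sup>+x. f x \<partial>lborel)"
proof -
  have "(\<integral>\<^sup>+x. f x \<partial>lborel) = (\<integral>\<^sup>+x. f x \<partial>distr lborel borel ((+) c))"
    by (simp add: lborel_distr_plus)
  also have "\<dots> = (\<integral>\<^sup>+x. f (c + x) \<partial>lborel)"
    by (rule nn_integral_distr) auto
  finally show ?thesis ..
qed

lemma emeasure_lborel_translation_vimage:
  fixes A :: "'a::euclidean_space set"
  assumes "A \<in> sets borel"
  shows "emeasure lborel {x. c + x \<in> A} = emeasure lborel A"
proof -
  have "emeasure lborel A = emeasure (distr lborel borel ((+) c)) A"
    by (simp add: lborel_distr_plus)
  also have "\<dots> = emeasure lborel {x. c + x \<in> A}"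
    using assms by (subst emeasure_distr) (auto simp: vimage_def)
  finally show ?thesis ..
qed

text \<open>The argument for the uniqueness of Haar measure, applied to Lebesgue measure and its image
  under a linear bijection \<open>g\<close>, which is translation invariant as well: the double integral of
  \<open>indicator E x * indicator F (x + g y)\<close> is evaluated in both orders.\<close>
lemma emeasure_linear_vimage_cross:
  fixes g h :: "'a::euclidean_space \<Rightarrow> 'a"
  assumes g: "linear g" and gh: "\<And>x. g (h x) = x"
    and [measurable]: "E \<in> sets borel" "F \<in> sets borel"
    and E_sym: "\<And>x. - x \<in> E \<longleftrightarrow> x \<in> E"
  shows "emeasure lborel E * emeasure lborel (g -` F) = emeasure lborel F * emeasure lborel (g -` E)"
proof -
  have g_meas [measurable]: "g \<in> borel_measurable borel"
    by (rule borel_measurable_continuous_onI[OF linear_continuous_on[OF linear_conv_bounded_linear[THEN iffD1, OF g]]])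
  have vimage_meas: "g -` A \<in> sets borel" if "A \<in> sets borel" for A
    using measurable_sets_borel[OF g_meas that] by simp
  have trans: "emeasure lborel {y. x + g y \<in> A} = emeasure lborel (g -` A)"
    if "A \<in> sets borel" for x A
  proof -
    have "{y. x + g y \<in> A} = {y. h x + y \<in> g -` A}"
      by (simp add: linear_add[OF g] gh)
    then show ?thesis using emeasure_lborel_translation_vimage[OF vimage_meas[OF that]] by simp
  qed
  have "emeasure lborel E * emeasure lborel (g -` F)
      = (\<integral>\<^sup>+x. indicator E x * emeasure lborel (g -` F) \<partial>lborel)"
    by (simp add: nn_integral_multc)
  also have "\<dots> = (\<integral>\<^sup>+x. \<integral>\<^sup>+y. indicator E x * indicator F (x + g y) \<partial>lborel \<partial>lborel)"
  proof (rule nn_integral_cong)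
    fix x :: 'a
    have "(\<integral>\<^sup>+y. indicator E x * indicator F (x + g y) \<partial>lborel)
        = indicator E x * (\<integral>\<^sup>+y. indicator {y. x + g y \<in> F} y \<partial>lborel)"
      by (subst nn_integral_cmult[symmetric]) (auto simp: indicator_def intro!: nn_integral_cong)
    also have "(\<integral>\<^sup>+y. indicator {y. x + g y \<in> F} y \<partial>lborel) = emeasure lborel (g -` F)"
      by (subst nn_integral_indicator) (auto simp: trans)
    finally show "indicator E x * emeasure lborel (g -` F)
        = (\<integral>\<^sup>+y. indicator E x * indicator F (x + g y) \<partial>lborel)" ..
  qed
  also have "\<dots> = (\<integral>\<^sup>+y. \<integral>\<^sup>+x. indicator E x * indicator F (x + g y) \<partial>lborel \<partial>lborel)"
    by (rule lborel_pair.Fubini') measurable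
  \<comment> \<open>Translating \<open>x\<close> by \<open>g y\<close> moves the dependence on \<open>y\<close> from \<open>F\<close> to \<open>E\<close>.\<close>
  also have "\<dots> = (\<integral>\<^sup>+y. \<integral>\<^sup>+x. indicator E (x - g y) * indicator F x \<partial>lborel \<partial>lborel)"
  proof (rule nn_integral_cong)
    fix y :: 'a
    show "(\<integral>\<^sup>+x. indicator E x * indicator F (x + g y) \<partial>lborel)
        = (\<integral>\<^sup>+x. indicator E (x - g y) * indicator F x \<partial>lborel)"
      by (subst nn_integral_lborel_translation[where c = "g y", symmetric])
         (auto simp: add.commute)
  qed
  also have "\<dots> = (\<integral>\<^sup>+x. \<integral>\<^sup>+y. indicator E (x - g y) * indicator F x \<partial>lborel \<partial>lborel)"
    by (rule lborel_pair.Fubini'[symmetric]) measurable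
  also have "\<dots> = (\<integral>\<^sup>+x. indicator F x * emeasure lborel (g -` E) \<partial>lborel)"
  proof (rule nn_integral_cong)
    fix x :: 'a
    have "(\<integral>\<^sup>+y. indicator E (x - g y) * indicator F x \<partial>lborel)
        = indicator F x * (\<integral>\<^sup>+y. indicator {y. - x + g y \<in> E} y \<partial>lborel)"
      using E_sym[of "x - g _"]
      by (subst nn_integral_cmult[symmetric]) (auto simp: indicator_def intro!: nn_integral_cong)
    also have "(\<integral>\<^sup>+y. indicator {y. - x + g y \<in> E} y \<partial>lborel) = emeasure lborel (g -` E)"
      by (subst nn_integral_indicator) (auto simp: trans simp del: uminus_add_conv_diff)
    finally show "(\<integral>\<^sup>+y. indicator E (x - g y) * indicator F x \<partial>lborel)
        = indicator F x * emeasure lborel (g -` E)" .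
  qed
  also have "\<dots> = emeasure lborel F * emeasure lborel (g -` E)"
    by (simp add: nn_integral_multc)
  finally show ?thesis .
qed

text \<open>By the identity above, a linear bijection multiplies Lebesgue measure by a constant, which is
  the ratio of the measures of the preimage of the unit ball and of the ball itself. A set of finite
  positive measure that is mapped onto itself forces this constant to be one. This is the change of
  variables for the symmetries of a polytope.\<close>
lemma distr_lborel_linear_preserving:
  fixes g :: "'a::euclidean_space \<Rightarrow> 'a"
  assumes g: "linear g" "inj g"
    and D: "D \<in> sets borel" "emeasure lborel D \<noteq> 0" "emeasure lborel D \<noteq> \<infinity>" "g ` D = D"
  shows "distr lborel borel g = lborel"
proof (rule measure_eqI)
  obtain h where gh: "\<And>x. g (h x) = x"
    using linear_injective_imp_surjective[OF g] by (metis surj_f_inv_f)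
  have g_meas [measurable]: "g \<in> borel_measurable borel"
    by (rule borel_measurable_continuous_onI[OF linear_continuous_on[OF linear_conv_bounded_linear[THEN iffD1, OF g(1)]]])
  let ?E = "ball 0 1 :: 'a set"
  have E: "emeasure lborel ?E \<noteq> \<infinity>" "emeasure lborel ?E \<noteq> 0"
    by (auto simp: emeasure_ball unit_ball_vol_pos[THEN less_imp_neq, THEN not_sym])
  have cross: "emeasure lborel ?E * emeasure lborel (g -` F) = emeasure lborel F * emeasure lborel (g -` ?E)"
    if "F \<in> sets borel" for F
    by (rule emeasure_linear_vimage_cross[OF g(1) gh]) (use that in auto)
  have "g -` D = D" using inj_vimage_image_eq[OF g(2), of D] D(4) by simp
  with cross[OF D(1)] D have "emeasure lborel ?E = emeasure lborel (g -` ?E)"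
    by (simp add: mult.commute[of _ "emeasure lborel D"] ennreal_mult_cancel_left)
  then show "emeasure (distr lborel borel g) F = emeasure lborel F"
    if "F \<in> sets (distr lborel borel g)" for F
    using cross[of F] that E
    by (simp add: emeasure_distr mult.commute[of _ "emeasure lborel (g -` ball 0 1)"] ennreal_mult_cancel_left)
qed simp

lemma prod_Basis_vec: "(\<Prod>b\<in>Basis. (x::real^'k) \<bullet> b) = (\<Prod>i\<in>UNIV. x $ i)"
  by (simp add: Basis_vec_def cart_eq_inner_axis axis_eq_axis prod.UNION_disjoint)

lemma append_coord_measurable [measurable]:
  "(\<lambda>(p, t). append_coord p t) \<in> borel_measurable (borel :: ((real^'n) \<times> real) measure)"
proof (rule borel_measurable_continuous_onI)
  show "continuous_on UNIV (\<lambda>(p::real^'n, t). append_coord p t)"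
    unfolding append_coord_def split_beta
  proof (rule continuous_on_vec_lambda)
    fix i :: "'n option"
    show "continuous_on UNIV (\<lambda>x::(real^'n) \<times> real. case i of None \<Rightarrow> snd x | Some j \<Rightarrow> fst x $ j)"
      by (cases i) (auto intro!: continuous_intros)
  qed
qed

text \<open>Fubini's theorem for the last coordinate: boxes of the space with one more coordinate are products
  of a box and an interval.\<close>
lemma lborel_append_coord:
  "(lborel :: (real^('n option)) measure)
     = distr (lborel :: ((real^'n) \<times> real) measure) borel (\<lambda>(p, t). append_coord p t)"
proof (rule lborel_eqI)
  fix l u :: "real^('n option)"
  assume le: "\<And>b. b \<in> Basis \<Longrightarrow> l \<bullet> b \<le> u \<bullet> b"
  have le': "l $ i \<le> u $ i" for i using le[of "axis i 1"] by (simp add: inner_axis)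
  let ?l = "\<chi> j. l $ Some j" and ?u = "\<chi> j. u $ Some j"
  have "(\<lambda>(p, t). append_coord p t) -` box l u = box ?l ?u \<times> box (l $ None) (u $ None)"
    by (auto simp: mem_box_cart split_option_all)
  then have "emeasure (distr (lborel :: ((real^'n) \<times> real) measure) borel (\<lambda>(p, t). append_coord p t)) (box l u)
      = emeasure (lborel \<Otimes>\<^sub>M lborel) (box ?l ?u \<times> box (l $ None) (u $ None))"
    by (subst emeasure_distr) (auto simp: lborel_prod)
  also have "\<dots> = emeasure lborel (box ?l ?u) * emeasure lborel (box (l $ None) (u $ None))"
    by (rule lborel.emeasure_pair_measure_Times) auto
  also have "\<dots> = ennreal (\<Prod>j\<in>UNIV. u $ Some j - l $ Some j) * ennreal (u $ None - l $ None)"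
    using le' by (subst emeasure_lborel_box) (auto simp: prod_Basis_vec, auto simp: Basis_vec_def inner_axis)
  also have "\<dots> = ennreal (\<Prod>i\<in>UNIV. (u - l) $ i)"
    using le' by (simp add: UNIV_option_conv prod.reindex ennreal_mult[symmetric] prod_nonneg mult.commute)
  finally show "emeasure (distr (lborel :: ((real^'n) \<times> real) measure) borel (\<lambda>(p, t). append_coord p t)) (box l u)
      = (\<Prod>b\<in>Basis. (u - l) \<bullet> b)"
    by (simp add: prod_Basis_vec)
qed simp

lemma nn_integral_append_coord:
  fixes f :: "real^('n::finite option) \<Rightarrow> ennreal"
  assumes [measurable]: "f \<in> borel_measurable borel"
  shows "(\<integral>\<^sup>+x. f x \<partial>lborel) = (\<integral>\<^sup>+t. \<integral>\<^sup>+p. f (append_coord p t) \<partial>lborel \<partial>lborel)"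
proof -
  have "(\<integral>\<^sup>+x. f x \<partial>lborel) = (\<integral>\<^sup>+z. f (case z of (p, t) \<Rightarrow> append_coord p t) \<partial>(lborel \<Otimes>\<^sub>M lborel))"
    by (subst lborel_append_coord, subst nn_integral_distr) (auto simp: lborel_prod)
  also have "\<dots> = (\<integral>\<^sup>+t. \<integral>\<^sup>+p. f (append_coord p t) \<partial>lborel \<partial>lborel)"
    by (subst lborel_pair.nn_integral_snd[symmetric]) (auto simp: lborel_prod)
  finally show ?thesis .
qed

section \<open>Lattice points in dilates of a convex body\<close>

lemma finite_bounded_integer_points:
  assumes "bounded S"
  shows "finite (S \<inter> (integer_points :: (real^'d) set))"
proof -
  obtain B where B: "\<And>x. x \<in> S \<Longrightarrow> norm x \<le> B" using assms by (auto simp: bounded_iff)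
  let ?I = "real_of_int ` {- \<lceil>B\<rceil>..\<lceil>B\<rceil>}"
  have "S \<inter> integer_points \<subseteq> vec_lambda ` (UNIV \<rightarrow>\<^sub>E ?I)"
  proof
    fix x assume x: "x \<in> S \<inter> (integer_points :: (real^'d) set)"
    have "x $ i \<in> ?I" for i
    proof -
      obtain z where z: "x $ i = real_of_int z" using x by (auto simp: integer_points_def elim: Ints_cases)
      have "\<bar>x $ i\<bar> \<le> B" using component_le_norm_cart[of x i] B[of x] x by simp
      then have "z \<in> {- \<lceil>B\<rceil>..\<lceil>B\<rceil>}" using z by (auto simp: ceiling_def; linarith)
      then show ?thesis using z by blast
    qed
    then show "x \<in> vec_lambda ` (UNIV \<rightarrow>\<^sub>E ?I)"
      by (intro image_eqI[of _ _ "vec_nth x"]) (auto simp: vec_nth_inverse)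
  qed
  then show ?thesis by (rule finite_subset) (auto intro!: finite_imageI finite_PiE)
qed

text \<open>The unit cubes at the lattice points of \<open>T\<close> cover \<open>S\<close>: rounding the coordinates of a point down
  moves it by at most the diameter of a unit cube.\<close>
lemma measure_le_lattice_count:
  fixes S T :: "(real^'d) set"
  assumes "bounded T" and "S \<in> lmeasurable"
    and near: "\<And>x y. x \<in> S \<Longrightarrow> norm (x - y) \<le> sqrt (real CARD('d)) \<Longrightarrow> y \<in> T"
  shows "measure lebesgue S \<le> real (lattice_count T)"
proof -
  let ?L = "T \<inter> integer_points"
  let ?box = "\<lambda>p::real^'d. cbox p (p + 1)"
  have fin: "finite ?L" by (rule finite_bounded_integer_points) fact
  have "S \<subseteq> (\<Union>p\<in>?L. ?box p)"
  proof
    fix x assume x: "x \<in> S"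
    define p :: "real^'d" where "p = (\<chi> i. real_of_int \<lfloor>x $ i\<rfloor>)"
    have "norm (x - p) \<le> sqrt (\<Sum>i\<in>(UNIV::'d set). 1\<^sup>2)"
      unfolding norm_vec_def L2_set_def
      by (intro real_sqrt_le_mono sum_mono power_mono) (auto simp: p_def, linarith)
    then have "p \<in> T" by (intro near[OF x]) simp
    moreover have "p \<in> integer_points" by (simp add: integer_points_def p_def)
    moreover have "x \<in> ?box p" by (auto simp: mem_box_cart p_def)
    ultimately show "x \<in> (\<Union>p\<in>?L. ?box p)" by blast
  qed
  then have "measure lebesgue S \<le> measure lebesgue (\<Union>p\<in>?L. ?box p)"
    using assms(2) fin by (intro measure_mono_fmeasurable) (auto intro: fmeasurable.finite_UN)
  also have "\<dots> \<le> (\<Sum>p\<in>?L. measure lebesgue (?box p))"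
    by (rule measure_UNION_le) (auto simp: fin)
  also have "\<dots> = (\<Sum>p\<in>?L. 1)"
    by (rule sum.cong) (auto simp: content_cbox_if_cart interval_eq_empty_cart)
  finally show ?thesis by (simp add: lattice_count_def)
qed

lemma Vol_scaleR_image:
  fixes Q :: "(real^'d) set"
  assumes "r \<ge> 0"
  shows "Vol ((\<lambda>x. r *\<^sub>R x) ` Q) = r ^ CARD('d) * Vol Q"
  using measure_lebesgue_affine[of r 0 Q] assms by (simp add: Vol_def)

text \<open>For large \<open>k\<close> the dilate of a slightly shrunken copy of \<open>Q\<close> stays at distance at least the
  diameter of a unit cube from the complement of \<open>k Q\<close>, so its volume is at most the lattice point
  count of \<open>k Q\<close>.\<close>
lemma lattice_count_dilate_eventually_ge:
  fixes Q :: "(real^'d) set"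
  assumes Q: "convex Q" "bounded Q" and pos: "Vol Q > 0" and s: "s < 1"
  shows "\<forall>\<^sub>F k in sequentially. s * (Vol Q * real k ^ CARD('d)) \<le> real (lattice_count (dilate k Q))"
proof -
  have "\<exists>r::real. 0 < r \<and> r < 1 \<and> s \<le> r ^ CARD('d)"
  proof -
    have "((\<lambda>r::real. r ^ CARD('d)) \<longlongrightarrow> 1 ^ CARD('d)) (at_left 1)"
      by (intro tendsto_power tendsto_ident_at)
    then have "\<forall>\<^sub>F r in at_left (1::real). s < r ^ CARD('d)" using s by (auto dest: order_tendstoD)
    moreover have "\<forall>\<^sub>F r in at_left (1::real). r \<in> {0<..<1}"
      by (rule eventually_at_leftI[of 0]) auto
    ultimately have "\<forall>\<^sub>F r in at_left (1::real). s < r ^ CARD('d) \<and> r \<in> {0<..<1}"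
      by (rule eventually_conj)
    from eventually_happens[OF this] show ?thesis by force
  qed
  then obtain r :: real where r: "0 < r" "r < 1" "s \<le> r ^ CARD('d)" by blast
  have "\<not> negligible Q"
    using pos by (auto simp: Vol_def negligible_iff_null_sets dest: measure_eq_0_null_sets)
  then have "interior Q \<noteq> {}" using Q(1) by (simp add: negligible_convex_interior)
  then obtain c e where c: "e > 0" "cball c e \<subseteq> Q" by (auto simp: mem_interior_cball)
  \<comment> \<open>Shrinking towards an interior point \<open>c\<close> moves \<open>Q\<close> away from its boundary.\<close>
  define S where "S = (\<lambda>x. r *\<^sub>R x + (1 - r) *\<^sub>R c) ` Q"
  have S_near: "y \<in> Q" if xS: "x \<in> S" and xy: "norm (x - y) \<le> (1 - r) * e" for x y
  proof -
    obtain q where q: "q \<in> Q" "x = r *\<^sub>R q + (1 - r) *\<^sub>R c" using xS unfolding S_def by blast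
    \<comment> \<open>If \<open>x\<close> comes from \<open>q\<close>, then \<open>y\<close> is the same convex combination of \<open>q\<close> and a point \<open>z\<close> near \<open>c\<close>.\<close>
    define z where "z = c + (1 / (1 - r)) *\<^sub>R (y - x)"
    have "norm (z - c) \<le> e"
      using xy r by (simp add: z_def norm_minus_commute pos_divide_le_eq mult.commute)
    then have "z \<in> Q" using c(2) by (auto simp: dist_norm norm_minus_commute subset_iff)
    then have "r *\<^sub>R q + (1 - r) *\<^sub>R z \<in> Q" using Q(1) q(1) r by (intro convexD) auto
    also have "r *\<^sub>R q + (1 - r) *\<^sub>R z = y"
      using r q(2) by (simp add: z_def scaleR_add_right)
    finally show ?thesis .
  qed
  have "S = (+) ((1 - r) *\<^sub>R c) ` ((\<lambda>x. r *\<^sub>R x) ` Q)"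
    by (auto simp: S_def image_image add.commute)
  then have S: "convex S" "bounded S"
    using Q by (auto intro: convex_translation convex_scaling bounded_translation bounded_scaling)
  have S_vol: "Vol S = r ^ CARD('d) * Vol Q"
    using measure_lebesgue_affine[of r "(1 - r) *\<^sub>R c" Q] r by (simp add: Vol_def S_def)
  have bound: "s * (Vol Q * real k ^ CARD('d)) \<le> real (lattice_count (dilate k Q))"
    if k: "real k \<ge> sqrt (real CARD('d)) / ((1 - r) * e)" "k \<ge> 1" for k
  proof -
    let ?kS = "(\<lambda>x. real k *\<^sub>R x) ` S"
    have "s * (Vol Q * real k ^ CARD('d)) \<le> r ^ CARD('d) * (Vol Q * real k ^ CARD('d))"
      using r(3) pos by (intro mult_right_mono) auto
    also have "\<dots> = Vol ?kS" by (simp add: Vol_scaleR_image S_vol)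
    also have "\<dots> \<le> real (lattice_count (dilate k Q))"
      unfolding Vol_def
    proof (rule measure_le_lattice_count)
      show "bounded (dilate k Q)" unfolding dilate_def by (rule bounded_scaling) fact
      show "?kS \<in> lmeasurable"
        using S by (intro measurable_convex convex_scaling bounded_scaling)
      fix x y assume x: "x \<in> ?kS" and xy: "norm (x - y) \<le> sqrt (real CARD('d))"
      obtain x' where x': "x' \<in> S" "x = real k *\<^sub>R x'" using x by blast
      let ?y = "(1 / real k) *\<^sub>R y"
      have "x - y = real k *\<^sub>R (x' - ?y)" using k by (simp add: x'(2) scaleR_diff_right)
      then have "real k * norm (x' - ?y) \<le> sqrt (real CARD('d))" using xy by simp
      also have "\<dots> \<le> real k * ((1 - r) * e)" using k(1) r c by (simp add: pos_divide_le_eq)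
      finally have "norm (x' - ?y) \<le> (1 - r) * e" using k by simp
      then have "?y \<in> Q" using S_near[OF x'(1)] by blast
      then show "y \<in> dilate k Q"
        unfolding dilate_def using k by (intro image_eqI[of _ _ ?y]) auto
    qed
    finally show ?thesis .
  qed
  have "\<forall>\<^sub>F k in sequentially. real k \<ge> sqrt (real CARD('d)) / ((1 - r) * e) \<and> k \<ge> 1"
    using eventually_conj[OF filterlim_real_sequentially[unfolded filterlim_at_top, rule_format] eventually_ge_at_top] .
  then show ?thesis by eventually_elim (use bound in auto)
qed

section \<open>Removing the invariance condition\<close>

lemma det_one_inj:
  fixes A :: "real^'d^'d"
  assumes "det A = 1"
  shows "inj (\<lambda>x. A *v x)"
  using assms inj_matrix_vector_mult invertible_det_nz[of A] by fastforce

lemma integer_matrix_vector_mult: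
  assumes "A \<in> SL_int" "x \<in> integer_points"
  shows "A *v x \<in> integer_points"
  using assms by (auto simp: SL_int_def integer_points_def matrix_vector_mult_def intro!: Ints_sum Ints_mult)

lemma sym_group_mult:
  assumes "A \<in> sym_group Q" "B \<in> sym_group Q"
  shows "A ** B \<in> sym_group Q"
proof -
  have "(\<lambda>x. (A ** B) *v x) ` Q = (\<lambda>x. A *v x) ` ((\<lambda>x. B *v x) ` Q)"
    by (simp add: image_image matrix_vector_mul_assoc)
  moreover have "(A ** B) $ i $ j \<in> \<int>" for i j
    using assms by (auto simp: sym_group_def SL_int_def matrix_matrix_mult_def intro!: Ints_sum Ints_mult)
  ultimately show ?thesis
    using assms by (simp add: sym_group_def SL_int_def det_mul)
qed

text \<open>A linear map that preserves a bounded set containing a ball has bounded entries, and there are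
  only finitely many integer matrices with bounded entries.\<close>
lemma finite_sym_group:
  fixes Q :: "(real^'d) set"
  assumes "bounded Q" "interior Q \<noteq> {}"
  shows "finite (sym_group Q)"
proof -
  obtain c e where c: "e > 0" "cball c e \<subseteq> Q" using assms(2) by (auto simp: mem_interior_cball)
  obtain R where R: "\<And>x. x \<in> Q \<Longrightarrow> norm x \<le> R" using assms(1) by (auto simp: bounded_iff)
  define M where "M = 2 * R / e"
  have entry: "\<bar>A $ i $ j\<bar> \<le> M" if A: "A \<in> sym_group Q" for A i j
  proof -
    have AQ: "A *v x \<in> Q" if "x \<in> Q" for x using A that by (auto simp: sym_group_def)
    have "A *v (c + e *\<^sub>R axis j 1) \<in> Q" "A *v c \<in> Q"
      using c by (auto intro!: AQ simp: subset_iff dist_norm)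
    then have "norm (A *v (c + e *\<^sub>R axis j 1) - A *v c) \<le> R + R"
      by (intro norm_triangle_le_diff add_mono R)
    also have "A *v (c + e *\<^sub>R axis j 1) - A *v c = e *\<^sub>R column j A"
      by (simp add: matrix_vector_right_distrib matrix_vector_mult_scaleR matrix_vector_mult_basis)
    finally have "norm (column j A) \<le> M" using c(1) by (simp add: M_def pos_le_divide_eq mult.commute)
    moreover have "\<bar>A $ i $ j\<bar> \<le> norm (column j A)"
      using component_le_norm_cart[of "column j A" i] by (simp add: column_def)
    ultimately show ?thesis by linarith
  qed
  let ?V = "{v :: real^'d. v \<in> integer_points \<and> (\<forall>j. \<bar>v $ j\<bar> \<le> M)}"
  have "bounded {v :: real^'d. \<forall>j. \<bar>v $ j\<bar> \<le> M}"
    by (rule bounded_subset[OF bounded_cbox[of "- (\<chi> j. M)" "\<chi> j. M"]])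
       (auto simp: mem_box_cart abs_le_iff minus_le_iff)
  from finite_bounded_integer_points[OF this] have "finite ?V"
    by (rule rev_finite_subset) auto
  then have "finite (vec_lambda ` (UNIV \<rightarrow>\<^sub>E ?V) :: (real^'d^'d) set)"
    by (intro finite_imageI finite_PiE) auto
  moreover have "sym_group Q \<subseteq> vec_lambda ` (UNIV \<rightarrow>\<^sub>E ?V)"
  proof
    fix A assume A: "A \<in> sym_group Q"
    then have "A $ i \<in> ?V" for i
      using entry[OF A] by (auto simp: integer_points_def sym_group_def SL_int_def)
    then show "A \<in> vec_lambda ` (UNIV \<rightarrow>\<^sub>E ?V)"
      by (intro image_eqI[of _ _ "vec_nth A"]) (auto simp: vec_nth_inverse)
  qed
  ultimately show ?thesis by (rule rev_finite_subset)
qed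

lemma matrix_image_dilate:
  assumes "(\<lambda>x. A *v x) ` Q = Q"
  shows "(\<lambda>x. A *v x) ` dilate k Q = dilate k Q"
proof -
  have "(\<lambda>x. A *v x) ` dilate k Q = (\<lambda>x. real k *\<^sub>R x) ` ((\<lambda>x. A *v x) ` Q)"
    by (simp add: dilate_def image_image matrix_vector_mult_scaleR)
  then show ?thesis using assms by (simp add: dilate_def)
qed

lemma compact_dilate: "compact Q \<Longrightarrow> compact (dilate k Q)"
  unfolding dilate_def by (rule compact_scaling)

lemma convex_dilate: "convex Q \<Longrightarrow> convex (dilate k Q)"
  unfolding dilate_def by (rule convex_scaling)

lemma Vol_dilate:
  fixes Q :: "(real^'d) set"
  shows "Vol (dilate k Q) = real k ^ CARD('d) * Vol Q"
  unfolding dilate_def by (simp add: Vol_scaleR_image)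

lemma set_integrable_continuous_compact:
  fixes f :: "real^'d \<Rightarrow> real"
  assumes "compact K" "continuous_on UNIV f"
  shows "set_integrable lebesgue K f"
    and "(LINT x:K|lebesgue. f x) = (LINT x:K|lborel. f x)"
proof -
  have K: "K \<in> sets borel" using assms(1) by (rule borel_compact)
  have f: "f \<in> borel_measurable borel" using assms(2) by (rule borel_measurable_continuous_onI)
  have "set_integrable lborel K f"
    unfolding set_integrable_def
    by (rule borel_integrable_compact[OF assms(1) continuous_on_subset[OF assms(2)]]) simp
  then show "set_integrable lebesgue K f"
    unfolding set_integrable_def by (rule integrable_completion[THEN iffD2, rotated]) (use K f in measurable)
  show "(LINT x:K|lebesgue. f x) = (LINT x:K|lborel. f x)"
    unfolding set_lebesgue_integral_def by (rule integral_completion) (use K f in measurable)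
qed

lemma sum_sym_group_invariant:
  assumes "A \<in> sym_group Q" "bounded (dilate k Q)"
  shows "(\<Sum>p\<in>dilate k Q \<inter> integer_points. f (A *v p)) = (\<Sum>p\<in>dilate k Q \<inter> integer_points. f p)"
proof (rule sum.reindex_bij_betw)
  let ?L = "dilate k Q \<inter> integer_points" and ?g = "\<lambda>x. A *v x"
  have AQ: "?g ` Q = Q" and A: "A \<in> SL_int" using assms(1) by (auto simp: sym_group_def)
  have inj: "inj_on ?g ?L" using det_one_inj[of A] A by (auto simp: SL_int_def intro: inj_on_subset)
  have sub: "?g ` ?L \<subseteq> ?L"
    using matrix_image_dilate[OF AQ, of k] integer_matrix_vector_mult[OF A] by blast
  show "bij_betw ?g ?L ?L"
    using inj endo_inj_surj[OF finite_bounded_integer_points[OF assms(2)] sub inj]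
    unfolding bij_betw_def by (rule conjI)
qed

lemma integral_sym_group_invariant:
  fixes f :: "real^'d \<Rightarrow> real"
  assumes A: "A \<in> sym_group Q" and Q: "compact (dilate k Q)" "Vol (dilate k Q) > 0"
    and f: "continuous_on UNIV f"
  shows "(LINT x:dilate k Q|lebesgue. f (A *v x)) = (LINT x:dilate k Q|lebesgue. f x)"
proof -
  let ?K = "dilate k Q" and ?g = "\<lambda>x. A *v x"
  have AQ: "?g ` Q = Q" and det: "det A = 1" using A by (auto simp: sym_group_def SL_int_def)
  have K: "?K \<in> sets borel" using Q(1) by (rule borel_compact)
  have inj: "inj ?g" by (rule det_one_inj[OF det])
  have AK: "?g ` ?K = ?K" by (rule matrix_image_dilate[OF AQ])
  have K_vimage: "?g x \<in> ?K \<longleftrightarrow> x \<in> ?K" for x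
    using AK inj_image_mem_iff[OF inj, of x ?K] by simp
  have vol: "measure lborel ?K > 0" using Q(2) K by (simp add: Vol_def measure_completion)
  have distr: "distr lborel borel ?g = lborel"
  proof (rule distr_lborel_linear_preserving[OF _ inj K _ _ AK])
    show "linear ?g" by (rule matrix_vector_mul_linear)
    show "emeasure lborel ?K \<noteq> 0" "emeasure lborel ?K \<noteq> \<infinity>"
      using vol by (auto simp: measure_def)
  qed
  have cont: "continuous_on UNIV ?g"
    by (intro linear_continuous_on matrix_vector_mul_bounded_linear)
  have g_meas [measurable]: "?g \<in> borel_measurable borel"
    by (rule borel_measurable_continuous_onI[OF cont])
  have f_meas [measurable]: "f \<in> borel_measurable borel"
    by (rule borel_measurable_continuous_onI[OF f])
  have "continuous_on UNIV (\<lambda>x. f (?g x))"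
    using continuous_on_compose2[OF f cont] by simp
  then have "(LINT x:?K|lebesgue. f (?g x)) = (LINT x:?K|lborel. f (?g x))"
    by (rule set_integrable_continuous_compact(2)[OF Q(1)])
  also have "\<dots> = (\<integral>x. indicator ?K (?g x) *\<^sub>R f (?g x) \<partial>lborel)"
    unfolding set_lebesgue_integral_def by (rule Bochner_Integration.integral_cong) (auto simp: indicator_def K_vimage)
  also have "\<dots> = (\<integral>x. indicator ?K x *\<^sub>R f x \<partial>distr lborel borel ?g)"
    by (rule integral_distr[symmetric]) (use K in measurable)
  also have "\<dots> = (LINT x:?K|lborel. f x)" unfolding distr set_lebesgue_integral_def ..
  also have "\<dots> = (LINT x:?K|lebesgue. f x)"
    by (rule set_integrable_continuous_compact(2)[OF Q(1) f, symmetric])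
  finally show ?thesis .
qed

text \<open>Both sides of the stability inequality are linear in the function and unchanged when it is
  composed with a symmetry, so summing a convex function over the finite symmetry group multiplies both
  sides by the order of the group. Convexity on the whole space makes the function continuous, hence
  integrable over \<open>k Q\<close>.\<close>
lemma semistable_without_invariance:
  fixes Q :: "(real^'d) set"
  assumes Q: "compact Q" "Vol Q > 0" "convex Q"
    and "asymptotically_Chow_semistable Q"
  obtains C where "\<And>k f. k \<ge> C \<Longrightarrow> k \<ge> 1 \<Longrightarrow> convex_on UNIV f \<Longrightarrow>
      1 / Vol (dilate k Q) * (LINT x:dilate k Q|lebesgue. f x)
        \<le> 1 / real (lattice_count (dilate k Q)) * (\<Sum>p\<in>dilate k Q \<inter> integer_points. f p)"
proof -
  let ?G = "sym_group Q"
  have "\<not> negligible Q"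
    using Q(2) by (auto simp: Vol_def negligible_iff_null_sets dest: measure_eq_0_null_sets)
  then have int: "interior Q \<noteq> {}" using Q(3) by (simp add: negligible_convex_interior)
  then have fin: "finite ?G" using finite_sym_group compact_imp_bounded[OF Q(1)] by blast
  have "mat 1 \<in> ?G"
    by (auto simp: sym_group_def SL_int_def) (auto simp: mat_def)
  then have card_pos: "card ?G > 0" using fin by (auto simp: card_gt_0_iff)
  obtain C where C: "\<And>k f. k \<ge> C \<Longrightarrow> convex_on (dilate k Q) f \<Longrightarrow>
      group_invariant_on ?G (dilate k Q) f \<Longrightarrow>
      1 / Vol (dilate k Q) * (LINT x:dilate k Q|lebesgue. f x)
        \<le> 1 / real (lattice_count (dilate k Q)) * (\<Sum>p\<in>dilate k Q \<inter> integer_points. f p)"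
    using assms(4) unfolding asymptotically_Chow_semistable_def by blast
  show ?thesis
  proof (rule that)
    fix k :: nat and f :: "real^'d \<Rightarrow> real"
    assume k: "k \<ge> C" "k \<ge> 1" and f: "convex_on UNIV f"
    let ?K = "dilate k Q"
    have K: "compact ?K" "convex ?K" "Vol ?K > 0"
      using Q k by (auto simp: compact_dilate convex_dilate Vol_dilate)
    have f_cont: "continuous_on UNIV f" using f by (intro convex_on_continuous) auto
    define F where "F x = (\<Sum>A\<in>?G. f (A *v x))" for x
    have gconv: "convex_on UNIV (\<lambda>x. f (A *v x))" for A
      using f by (auto simp: convex_on_def matrix_vector_right_distrib matrix_vector_mult_scaleR)
    have "convex_on UNIV (\<lambda>x. \<Sum>A\<in>H. f (A *v x))" if "finite H" for H
      using that by (induction H rule: finite_induct) (auto intro: convex_on_add gconv simp: convex_on_const)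
    then have "convex_on UNIV F" unfolding F_def using fin by blast
    then have F_convex: "convex_on ?K F" using K(2) by (auto intro: convex_on_subset)
    have F_inv: "group_invariant_on ?G ?K F"
      unfolding group_invariant_on_def
    proof (intro ballI)
      fix B x assume B: "B \<in> ?G"
      have det: "det B \<noteq> 0" using B by (auto simp: sym_group_def SL_int_def)
      then obtain B' where B': "B ** B' = mat 1"
        unfolding invertible_det_nz[symmetric] invertible_def by blast
      \<comment> \<open>Right multiplication by \<open>B\<close> permutes the group.\<close>
      have "inj_on (\<lambda>A. A ** B) ?G"
      proof (rule inj_onI)
        fix A A' assume "A ** B = A' ** B"
        then have "A ** B ** B' = A' ** B ** B'" by simp
        then show "A = A'" by (simp add: matrix_mul_assoc[symmetric] B')
      qed
      moreover have "(\<lambda>A. A ** B) ` ?G \<subseteq> ?G" using sym_group_mult[OF _ B] by blast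
      ultimately have "bij_betw (\<lambda>A. A ** B) ?G ?G"
        using endo_inj_surj[OF fin] by (simp add: bij_betw_def)
      from sum.reindex_bij_betw[OF this, of "\<lambda>A. f (A *v x)"]
      show "F (B *v x) = F x" by (simp add: F_def matrix_vector_mul_assoc)
    qed
    have gcont: "continuous_on UNIV (\<lambda>x. f (A *v x))" for A :: "real^'d^'d"
      by (rule continuous_on_compose2[OF f_cont linear_continuous_on[OF matrix_vector_mul_bounded_linear]]) auto
    have "(LINT x:?K|lebesgue. F x) = (\<Sum>A\<in>?G. LINT x:?K|lebesgue. f (A *v x))"
      unfolding F_def set_lebesgue_integral_def scaleR_sum_right
      using set_integrable_continuous_compact(1)[OF K(1) gcont]
      by (intro Bochner_Integration.integral_sum) (auto simp: set_integrable_def)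
    also have "\<dots> = real (card ?G) * (LINT x:?K|lebesgue. f x)"
      using integral_sym_group_invariant[OF _ K(1) K(3) f_cont] by simp
    finally have int_F: "(LINT x:?K|lebesgue. F x) = real (card ?G) * (LINT x:?K|lebesgue. f x)" .
    have "(\<Sum>p\<in>?K \<inter> integer_points. F p) = (\<Sum>A\<in>?G. \<Sum>p\<in>?K \<inter> integer_points. f (A *v p))"
      unfolding F_def by (rule sum.swap)
    also have "\<dots> = (\<Sum>A\<in>?G. \<Sum>p\<in>?K \<inter> integer_points. f p)"
      by (rule sum.cong[OF refl], rule sum_sym_group_invariant[OF _ compact_imp_bounded[OF K(1)]])
    also have "\<dots> = real (card ?G) * (\<Sum>p\<in>?K \<inter> integer_points. f p)" by simp
    finally have sum_F: "(\<Sum>p\<in>?K \<inter> integer_points. F p) = real (card ?G) * (\<Sum>p\<in>?K \<inter> integer_points. f p)" .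
    have "real (card ?G) * (1 / Vol ?K * (LINT x:?K|lebesgue. f x))
        \<le> real (card ?G) * (1 / real (lattice_count ?K) * (\<Sum>p\<in>?K \<inter> integer_points. f p))"
      using C[OF k(1) F_convex F_inv] unfolding int_F sum_F by (simp add: mult_ac)
    then show "1 / Vol ?K * (LINT x:?K|lebesgue. f x)
        \<le> 1 / real (lattice_count ?K) * (\<Sum>p\<in>?K \<inter> integer_points. f p)"
      using card_pos by (subst (asm) mult_le_cancel_left_pos) simp_all
  qed
qed

section \<open>Slices of the double cone\<close>

definition base_coords :: "real^('n option) \<Rightarrow> real^('n::finite)" where
  "base_coords x = (\<chi> j. x $ Some j)"

lemma base_coords_append_coord [simp]: "base_coords (append_coord p t) = p"
  by (simp add: base_coords_def vec_eq_iff)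

lemma append_coord_base_coords [simp]: "append_coord (base_coords x) (x $ None) = x"
  by (simp add: base_coords_def append_coord_def vec_eq_iff split: option.split)

lemma append_coord_add: "append_coord p s + append_coord q t = append_coord (p + q) (s + t)"
  by (simp add: append_coord_def vec_eq_iff split: option.split)

lemma append_coord_scaleR: "c *\<^sub>R append_coord p t = append_coord (c *\<^sub>R p) (c * t)"
  by (simp add: append_coord_def vec_eq_iff split: option.split)

lemma append_coord_integer_points:
  "append_coord p t \<in> integer_points \<longleftrightarrow> p \<in> integer_points \<and> t \<in> \<int>"
  by (auto simp: integer_points_def split_option_all)

text \<open>Scalings of a convex set containing the origin add up, and they grow with the factor. This is
  the convexity of the cone over the set.\<close>
lemma convex_combination_scaled:
  fixes P :: "'a::real_vector set"
  assumes P: "convex P" "0 \<in> P" and nn: "a \<ge> 0" "b \<ge> 0" "u \<ge> 0" "v \<ge> 0" and le: "u * a + v * b \<le> c"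
    and x: "x \<in> (\<lambda>p. a *\<^sub>R p) ` P" and y: "y \<in> (\<lambda>p. b *\<^sub>R p) ` P"
  shows "u *\<^sub>R x + v *\<^sub>R y \<in> (\<lambda>p. c *\<^sub>R p) ` P"
proof -
  obtain p q where pq: "p \<in> P" "q \<in> P" "x = a *\<^sub>R p" "y = b *\<^sub>R q" using x y by blast
  have nn': "u * a \<ge> 0" "v * b \<ge> 0" using nn by auto
  show ?thesis
  proof (cases "c = 0")
    case True
    then have "u * a = 0" "v * b = 0" using nn' le by linarith+
    then have z: "(u * a) *\<^sub>R p = 0" "(v * b) *\<^sub>R q = 0" by simp_all
    have "u *\<^sub>R x + v *\<^sub>R y = c *\<^sub>R 0" by (simp only: pq scaleR_scaleR z add_0 scaleR_zero_right)
    then show ?thesis using P(2) by blast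
  next
    case False
    then have c: "c > 0" using nn' le by linarith
    let ?r = "(u * a / c) *\<^sub>R p + (v * b / c) *\<^sub>R q + (1 - u * a / c - v * b / c) *\<^sub>R 0"
    have "0 \<le> 1 - u * a / c - v * b / c"
      using le c by (simp add: diff_diff_eq add_divide_distrib[symmetric])
    then have "?r \<in> convex hull {p, q, 0}"
      unfolding convex_hull_3 using nn' c
      by (intro CollectI exI[of _ "u * a / c"] exI[of _ "v * b / c"] exI[of _ "1 - u * a / c - v * b / c"]) auto
    also have "convex hull {p, q, 0} \<subseteq> P"
      using P pq by (intro hull_minimal) auto
    finally have "?r \<in> P" .
    moreover have "u *\<^sub>R x + v *\<^sub>R y = c *\<^sub>R ?r" using c by (simp add: pq scaleR_add_right)
    ultimately show ?thesis by blast
  qed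
qed

text \<open>The segment between the apexes passes through the origin, so the slice of the double cone at
  height zero is the hull of \<open>P\<close> and the origin. If the origin lies outside \<open>P\<close>, this is larger
  than \<open>P\<close>.\<close>
lemma append_coord_mem_double_cone:
  fixes P :: "(real^'n) set"
  defines "P0 \<equiv> convex hull (insert 0 P)"
  shows "append_coord p t \<in> double_cone P \<longleftrightarrow> \<bar>t\<bar> \<le> 1 \<and> p \<in> (\<lambda>x. (1 - \<bar>t\<bar>) *\<^sub>R x) ` P0"
proof -
  have P0: "convex P0" "0 \<in> P0" "P \<subseteq> P0"
    unfolding P0_def using hull_subset[of "insert 0 P" convex] by auto
  define S where "S = {x. \<bar>x $ None\<bar> \<le> 1 \<and> base_coords x \<in> (\<lambda>x'. (1 - \<bar>x $ None\<bar>) *\<^sub>R x') ` P0}"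
  let ?gen = "{append_coord 0 1, append_coord 0 (-1)} \<union> {append_coord p 0 | p. p \<in> P}"
  have "convex S"
  proof (rule convexI)
    fix x y u v
    assume xy: "x \<in> S" "y \<in> S" and uv: "0 \<le> u" "0 \<le> v" "u + v = (1::real)"
    let ?z = "u *\<^sub>R x + v *\<^sub>R y"
    have "\<bar>?z $ None\<bar> \<le> \<bar>u * x $ None\<bar> + \<bar>v * y $ None\<bar>" by simp
    also have "\<dots> = u * \<bar>x $ None\<bar> + v * \<bar>y $ None\<bar>" using uv by (simp add: abs_mult)
    finally have le: "\<bar>?z $ None\<bar> \<le> u * \<bar>x $ None\<bar> + v * \<bar>y $ None\<bar>" .
    have "u * \<bar>x $ None\<bar> + v * \<bar>y $ None\<bar> \<le> u * 1 + v * 1"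
      using xy uv by (intro add_mono mult_left_mono) (auto simp: S_def)
    then have "\<bar>?z $ None\<bar> \<le> 1" using le uv by linarith
    moreover have "u * (1 - \<bar>x $ None\<bar>) + v * (1 - \<bar>y $ None\<bar>) \<le> 1 - \<bar>?z $ None\<bar>"
      using le uv by (simp add: right_diff_distrib)
    then have "u *\<^sub>R base_coords x + v *\<^sub>R base_coords y \<in> (\<lambda>x'. (1 - \<bar>?z $ None\<bar>) *\<^sub>R x') ` P0"
      using xy uv by (intro convex_combination_scaled[OF P0(1,2), where a = "1 - \<bar>x $ None\<bar>" and b = "1 - \<bar>y $ None\<bar>"]) (auto simp: S_def)
    moreover have "base_coords ?z = u *\<^sub>R base_coords x + v *\<^sub>R base_coords y" by (simp add: base_coords_def vec_eq_iff)
    ultimately show "?z \<in> S" by (simp add: S_def)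
  qed
  moreover have "?gen \<subseteq> S" using P0 by (auto simp: S_def)
  ultimately have sub: "double_cone P \<subseteq> S" unfolding double_cone_def by (rule hull_minimal[rotated])
  have apex: "append_coord 0 1 \<in> double_cone P" "append_coord 0 (-1) \<in> double_cone P"
    and P_sub: "(\<lambda>p. append_coord p 0) ` P \<subseteq> double_cone P"
    unfolding double_cone_def by (auto intro!: hull_inc)
  have conv: "convex (double_cone P)" unfolding double_cone_def by (rule convex_convex_hull)
  have "(1/2) *\<^sub>R append_coord 0 1 + (1/2) *\<^sub>R append_coord 0 (-1) \<in> double_cone P"
    by (rule convexD[OF conv apex]) auto
  then have "append_coord 0 0 \<in> double_cone P" by (simp add: append_coord_scaleR append_coord_add)
  then have "(\<lambda>p. append_coord p 0) ` insert 0 P \<subseteq> double_cone P" using P_sub by blast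
  then have "convex hull ((\<lambda>p. append_coord p 0) ` insert 0 P) \<subseteq> double_cone P"
    using conv by (rule hull_minimal)
  then have P0_sub: "append_coord q 0 \<in> double_cone P" if "q \<in> P0" for q
    using that convex_hull_linear_image[OF linear_append_coord, of "insert 0 P"]
    unfolding P0_def by blast
  show ?thesis
  proof
    assume "append_coord p t \<in> double_cone P"
    with sub have "append_coord p t \<in> S" by blast
    then show "\<bar>t\<bar> \<le> 1 \<and> p \<in> (\<lambda>x. (1 - \<bar>t\<bar>) *\<^sub>R x) ` P0" by (simp add: S_def)
  next
    assume *: "\<bar>t\<bar> \<le> 1 \<and> p \<in> (\<lambda>x. (1 - \<bar>t\<bar>) *\<^sub>R x) ` P0"
    then obtain q where q: "q \<in> P0" "p = (1 - \<bar>t\<bar>) *\<^sub>R q" by blast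
    let ?a = "append_coord 0 (if t \<ge> 0 then 1 else - 1)"
    have "\<bar>t\<bar> *\<^sub>R ?a + (1 - \<bar>t\<bar>) *\<^sub>R append_coord q 0 \<in> double_cone P"
      by (rule convexD[OF conv _ P0_sub[OF q(1)]]) (use * apex in auto)
    then show "append_coord p t \<in> double_cone P"
      by (simp add: append_coord_scaleR append_coord_add q(2) split: if_splits)
  qed
qed

lemma append_coord_mem_dilate_double_cone:
  fixes P :: "(real^'n) set"
  defines "P0 \<equiv> convex hull (insert 0 P)"
  assumes k: "k \<ge> 1"
  shows "append_coord p t \<in> dilate k (double_cone P)
    \<longleftrightarrow> \<bar>t\<bar> \<le> real k \<and> p \<in> (\<lambda>x. (real k - \<bar>t\<bar>) *\<^sub>R x) ` P0"
proof -
  have k0: "real k > 0" using k by simp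
  have "append_coord p t \<in> dilate k (double_cone P)
      \<longleftrightarrow> append_coord ((1 / real k) *\<^sub>R p) (t / real k) \<in> double_cone P"
  proof
    assume "append_coord p t \<in> dilate k (double_cone P)"
    then obtain x where x: "x \<in> double_cone P" "append_coord p t = real k *\<^sub>R x"
      by (auto simp: dilate_def)
    have "append_coord ((1 / real k) *\<^sub>R p) (t / real k) = (1 / real k) *\<^sub>R append_coord p t"
      by (simp add: append_coord_scaleR)
    also have "\<dots> = x" using k0 by (simp add: x(2))
    finally show "append_coord ((1 / real k) *\<^sub>R p) (t / real k) \<in> double_cone P" using x by simp
  next
    assume *: "append_coord ((1 / real k) *\<^sub>R p) (t / real k) \<in> double_cone P"
    have "append_coord p t = real k *\<^sub>R append_coord ((1 / real k) *\<^sub>R p) (t / real k)"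
      using k0 by (simp add: append_coord_scaleR)
    with * show "append_coord p t \<in> dilate k (double_cone P)" unfolding dilate_def by blast
  qed
  also have "\<dots> \<longleftrightarrow> \<bar>t\<bar> \<le> real k \<and> (1 / real k) *\<^sub>R p \<in> (\<lambda>x. (1 - \<bar>t / real k\<bar>) *\<^sub>R x) ` P0"
    using k0 by (simp add: append_coord_mem_double_cone P0_def pos_divide_le_eq)
  also have "(1 / real k) *\<^sub>R p \<in> (\<lambda>x. (1 - \<bar>t / real k\<bar>) *\<^sub>R x) ` P0
      \<longleftrightarrow> p \<in> (\<lambda>x. (real k - \<bar>t\<bar>) *\<^sub>R x) ` P0"
  proof -
    have "(1 / real k) *\<^sub>R p = (1 - \<bar>t / real k\<bar>) *\<^sub>R q \<longleftrightarrow> p = (real k - \<bar>t\<bar>) *\<^sub>R q" for q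
    proof -
      have "(1 / real k) *\<^sub>R p = (1 - \<bar>t / real k\<bar>) *\<^sub>R q
          \<longleftrightarrow> real k *\<^sub>R ((1 / real k) *\<^sub>R p) = real k *\<^sub>R ((1 - \<bar>t / real k\<bar>) *\<^sub>R q)"
        using k0 by (simp only: real_vector.scale_cancel_left) simp
      also have "real k * (1 - \<bar>t / real k\<bar>) = real k - \<bar>t\<bar>" using k0 by (simp add: right_diff_distrib)
      then have "real k *\<^sub>R ((1 - \<bar>t / real k\<bar>) *\<^sub>R q) = (real k - \<bar>t\<bar>) *\<^sub>R q" by simp
      finally show ?thesis using k0 by simp
    qed
    then show ?thesis by (auto simp: image_iff)
  qed
  finally show ?thesis .
qed

lemma nn_integral_even:
  fixes g :: "real \<Rightarrow> ennreal"
  assumes [measurable]: "g \<in> borel_measurable borel" and even: "\<And>t. g (- t) = g t"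
  shows "(\<integral>\<^sup>+t. g t \<partial>lborel) = 2 * (\<integral>\<^sup>+t. g t * indicator {0..} t \<partial>lborel)"
proof -
  have "(\<integral>\<^sup>+t. g t \<partial>lborel) = (\<integral>\<^sup>+t. g t * indicator {0..} t + g t * indicator {..0} t \<partial>lborel)"
    by (intro nn_integral_cong_AE AE_I[of _ _ "{0}"]) (auto simp: indicator_def)
  also have "\<dots> = (\<integral>\<^sup>+t. g t * indicator {0..} t \<partial>lborel) + (\<integral>\<^sup>+t. g t * indicator {..0} t \<partial>lborel)"
    by (rule nn_integral_add) auto
  also have "(\<integral>\<^sup>+t. g t * indicator {..0} t \<partial>lborel) = (\<integral>\<^sup>+t. g t * indicator {0..} t \<partial>lborel)"
    by (subst nn_integral_real_affine[of _ "-1" 0])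
       (auto simp: even indicator_def intro!: nn_integral_cong)
  finally show ?thesis by (simp add: mult_2)
qed

text \<open>Integration over the slices: the slice at height \<open>t\<close> contributes its volume, which is
  \<open>Vol P0 * (k - \<bar>t\<bar>) ^ n\<close>, and the upper and the lower half contribute equally. The lower limit \<open>a\<close>
  allows for an antiderivative that is only valid on the part where \<open>\<phi>\<close> is supported.\<close>
lemma integral_height_double_cone:
  fixes P :: "(real^'n) set" and \<phi> F :: "real \<Rightarrow> real"
  defines "P0 \<equiv> convex hull (insert 0 P)"
  assumes P: "compact P" and k: "k \<ge> 1" and a: "0 \<le> a" "a \<le> real k"
    and \<phi>: "continuous_on UNIV \<phi>" "\<And>s. \<phi> s \<ge> 0" "\<And>s. 0 \<le> s \<Longrightarrow> s < a \<Longrightarrow> \<phi> s = 0"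
    and F: "\<And>s. a \<le> s \<Longrightarrow> s \<le> real k \<Longrightarrow> (F has_real_derivative \<phi> s * (real k - s) ^ CARD('n)) (at s)"
  shows "(LINT x:dilate k (double_cone P)|lebesgue. \<phi> \<bar>x $ None\<bar>) = 2 * Vol P0 * (F (real k) - F a)"
proof -
  let ?K = "dilate k (double_cone P)" and ?n = "CARD('n)"
  have P0: "compact P0" "convex P0" unfolding P0_def using P by (auto intro: compact_convex_hull)
  have "compact {append_coord p 0 | p. p \<in> P}"
    using compact_continuous_image[OF linear_continuous_on[OF linear_conv_bounded_linear[THEN iffD1, OF linear_append_coord]] P]
    by (simp add: Setcompr_eq_image)
  then have "compact (double_cone P)" unfolding double_cone_def by (intro compact_convex_hull compact_Un) auto
  then have K: "?K \<in> sets borel" by (intro borel_compact compact_dilate)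
  have [measurable]: "\<phi> \<in> borel_measurable borel" by (rule borel_measurable_continuous_onI[OF \<phi>(1)])
  have [measurable]: "(\<lambda>x::real^('n option). x $ None) \<in> borel_measurable borel"
    by (intro borel_measurable_continuous_onI continuous_intros)
  note K [measurable]
  have slice: "(\<integral>\<^sup>+p. ennreal (indicator ?K (append_coord p t) * \<phi> \<bar>append_coord p t $ None\<bar>) \<partial>lborel)
      = ennreal (indicator {- real k..real k} t * (\<phi> \<bar>t\<bar> * (Vol P0 * (real k - \<bar>t\<bar>) ^ ?n)))" for t
  proof (cases "\<bar>t\<bar> \<le> real k")
    case True
    let ?S = "(\<lambda>x. (real k - \<bar>t\<bar>) *\<^sub>R x) ` P0"
    have S: "compact ?S" using P0(1) by (rule compact_scaling)
    have "(\<integral>\<^sup>+p. ennreal (indicator ?K (append_coord p t) * \<phi> \<bar>append_coord p t $ None\<bar>) \<partial>lborel)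
        = (\<integral>\<^sup>+p. ennreal (\<phi> \<bar>t\<bar>) * indicator ?S p \<partial>lborel)"
      using True append_coord_mem_dilate_double_cone[OF k, where P = P and t = t]
      by (intro nn_integral_cong) (auto simp: indicator_def P0_def)
    also have "\<dots> = ennreal (\<phi> \<bar>t\<bar>) * emeasure lborel ?S"
      using borel_compact[OF S] by (simp add: nn_integral_cmult_indicator)
    also have "emeasure lborel ?S = ennreal (Vol ?S)"
      using borel_compact[OF S] emeasure_compact_finite[OF S]
      by (simp add: Vol_def measure_completion emeasure_eq_ennreal_measure)
    also have "Vol ?S = Vol P0 * (real k - \<bar>t\<bar>) ^ ?n" using True by (simp add: Vol_scaleR_image)
    finally show ?thesis using True \<phi>(2) by (simp add: ennreal_mult' abs_le_iff minus_le_iff)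
  next
    case False
    then have "t \<notin> {- real k..real k}" by auto
    moreover have "append_coord p t \<notin> ?K" for p
      using append_coord_mem_dilate_double_cone[OF k, of p t P] False by blast
    ultimately show ?thesis by simp
  qed
  have "(\<integral>\<^sup>+x. ennreal (indicator ?K x * \<phi> \<bar>x $ None\<bar>) \<partial>lborel)
      = (\<integral>\<^sup>+t. ennreal (indicator {- real k..real k} t * (\<phi> \<bar>t\<bar> * (Vol P0 * (real k - \<bar>t\<bar>) ^ ?n))) \<partial>lborel)"
    by (subst nn_integral_append_coord) (simp_all only: slice, measurable)
  also have "\<dots> = 2 * (\<integral>\<^sup>+t. ennreal (indicator {- real k..real k} t * (\<phi> \<bar>t\<bar> * (Vol P0 * (real k - \<bar>t\<bar>) ^ ?n))) * indicator {0..} t \<partial>lborel)"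
    by (rule nn_integral_even) (measurable, auto simp: indicator_def)
  also have "(\<integral>\<^sup>+t. ennreal (indicator {- real k..real k} t * (\<phi> \<bar>t\<bar> * (Vol P0 * (real k - \<bar>t\<bar>) ^ ?n))) * indicator {0..} t \<partial>lborel)
      = (\<integral>\<^sup>+t. ennreal (Vol P0) * (ennreal (\<phi> t * (real k - t) ^ ?n) * indicator {a..real k} t) \<partial>lborel)"
  proof (rule nn_integral_cong)
    fix t :: real
    show "ennreal (indicator {- real k..real k} t * (\<phi> \<bar>t\<bar> * (Vol P0 * (real k - \<bar>t\<bar>) ^ ?n))) * indicator {0..} t
        = ennreal (Vol P0) * (ennreal (\<phi> t * (real k - t) ^ ?n) * indicator {a..real k} t)"
    proof (cases "a \<le> t \<and> t \<le> real k")
      case True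
      then show ?thesis using a \<phi>(2)[of t]
        by (simp add: indicator_def ennreal_mult'[symmetric] Vol_def mult_ac)
    next
      case False
      then show ?thesis using a \<phi>(3)[of t] by (auto simp: indicator_def)
    qed
  qed
  also have "\<dots> = ennreal (Vol P0) * (\<integral>\<^sup>+t. ennreal (\<phi> t * (real k - t) ^ ?n) * indicator {a..real k} t \<partial>lborel)"
    by (rule nn_integral_cmult) measurable
  also have "(\<integral>\<^sup>+t. ennreal (\<phi> t * (real k - t) ^ ?n) * indicator {a..real k} t \<partial>lborel) = ennreal (F (real k) - F a)"
    by (rule nn_integral_FTC_Icc) (use F \<phi>(2) a in auto)
  finally have nn: "(\<integral>\<^sup>+x. ennreal (indicator ?K x * \<phi> \<bar>x $ None\<bar>) \<partial>lborel)
      = 2 * (ennreal (Vol P0) * ennreal (F (real k) - F a))" .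
  have F_mono: "F a \<le> F (real k)"
    using F \<phi>(2) a by (intro DERIV_nonneg_imp_nondecreasing[OF a(2)]) (metis diff_ge_0_iff_ge mult_nonneg_nonneg zero_le_power)
  have "(LINT x:?K|lebesgue. \<phi> \<bar>x $ None\<bar>) = (\<integral>x. indicator ?K x * \<phi> \<bar>x $ None\<bar> \<partial>lborel)"
    unfolding set_lebesgue_integral_def real_scaleR_def by (rule integral_completion) measurable
  also have "\<dots> = enn2real (2 * (ennreal (Vol P0) * ennreal (F (real k) - F a)))"
    by (subst integral_eq_nn_integral) (auto simp: nn \<phi>(2))
  also have "\<dots> = 2 * Vol P0 * (F (real k) - F a)"
    using F_mono by (simp add: enn2real_mult Vol_def)
  finally show ?thesis .
qed

lemma has_derivative_reflected_power:
  "((\<lambda>s. (c - s) ^ (n + 1) / real (n + 1)) has_real_derivative - ((c - s) ^ n)) (at s)"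
proof -
  have "((\<lambda>s. c - s) has_real_derivative - 1) (at s)"
    by (auto intro!: derivative_eq_intros)
  from DERIV_cdivide[OF DERIV_power[OF this, of "Suc n"], of "real (Suc n)"] show ?thesis
    by (simp del: of_nat_Suc power_Suc)
qed

lemma Vol_dilate_double_cone:
  fixes P :: "(real^'n) set"
  assumes P: "compact P" and k: "k \<ge> 1"
  shows "Vol (dilate k (double_cone P))
    = 2 * Vol (convex hull (insert 0 P)) * real k ^ (CARD('n) + 1) / real (CARD('n) + 1)"
proof -
  let ?F = "\<lambda>s. - ((real k - s) ^ (CARD('n) + 1) / real (CARD('n) + 1))"
  have "(LINT x:dilate k (double_cone P)|lebesgue. (\<lambda>_. 1) \<bar>x $ None\<bar>)
      = 2 * Vol (convex hull (insert 0 P)) * (?F (real k) - ?F 0)"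
  proof (rule integral_height_double_cone[OF P k, where a = 0 and F = ?F and \<phi> = "\<lambda>_. 1"])
    show "(?F has_real_derivative 1 * (real k - s) ^ CARD('n)) (at s)" for s
      using DERIV_minus[OF has_derivative_reflected_power[of "real k" "CARD('n)" s]] by simp
  qed auto
  then show ?thesis by (simp add: Vol_def set_lebesgue_integral_def)
qed

text \<open>In terms of the distance \<open>u = k - s\<close> from the apex, the integrand is \<open>(m - u) * u ^ n\<close> for
  \<open>u\<close> between \<open>0\<close> and \<open>m\<close>.\<close>
lemma integral_cap_double_cone:
  fixes P :: "(real^'n) set"
  assumes P: "compact P" and k: "k \<ge> 1" and m: "m \<le> k"
  shows "(LINT x:dilate k (double_cone P)|lebesgue. max 0 (\<bar>x $ None\<bar> - real (k - m)))
    = 2 * Vol (convex hull (insert 0 P)) * real m ^ (CARD('n) + 2) / (real (CARD('n) + 1) * real (CARD('n) + 2))"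
proof -
  let ?n = "CARD('n)"
  let ?F = "\<lambda>s. (real k - s) ^ (?n + 2) / real (?n + 2) - real m * ((real k - s) ^ (?n + 1) / real (?n + 1))"
  have "(LINT x:dilate k (double_cone P)|lebesgue. max 0 (\<bar>x $ None\<bar> - real (k - m)))
      = 2 * Vol (convex hull (insert 0 P)) * (?F (real k) - ?F (real (k - m)))"
  proof (rule integral_height_double_cone[OF P k, where a = "real (k - m)" and F = ?F and \<phi> = "\<lambda>s. max 0 (s - real (k - m))"])
    fix s assume s: "real (k - m) \<le> s" "s \<le> real k"
    have "(?F has_real_derivative - ((real k - s) ^ (?n + 1)) + real m * (real k - s) ^ ?n) (at s)"
      using DERIV_diff[OF has_derivative_reflected_power[of "real k" "?n + 1" s]
          DERIV_cmult[OF has_derivative_reflected_power[of "real k" ?n s], of "real m"]]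
      by (simp del: of_nat_add of_nat_Suc power_Suc)
    also have "- ((real k - s) ^ (?n + 1)) + real m * (real k - s) ^ ?n
        = max 0 (s - real (k - m)) * (real k - s) ^ ?n"
      using s m by (simp add: of_nat_diff algebra_simps)
    finally show "(?F has_real_derivative max 0 (s - real (k - m)) * (real k - s) ^ ?n) (at s)" .
  qed (auto intro!: continuous_intros)
  also have "?F (real k) - ?F (real (k - m)) = real m ^ (?n + 2) / (real (?n + 1) * real (?n + 2))"
    using m by (simp add: of_nat_diff divide_simps) (simp add: algebra_simps)
  finally show ?thesis by simp
qed

lemma sum_symmetric_interval:
  fixes g :: "nat \<Rightarrow> real"
  shows "(\<Sum>t\<in>{- int k..int k}. g (nat \<bar>t\<bar>)) = g 0 + 2 * (\<Sum>j<k. g (k - j))"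
proof -
  have "(\<Sum>t\<in>{- int k..int k}. g (nat \<bar>t\<bar>)) = g 0 + 2 * (\<Sum>j<k. g (Suc j))"
  proof (induction k)
    case (Suc k)
    have "{- int (Suc k)..int (Suc k)} = insert (- int (Suc k)) (insert (int (Suc k)) {- int k..int k})"
      by auto
    then show ?case using Suc by (simp add: nat_add_distrib)
  qed simp
  also have "(\<Sum>j<k. g (Suc j)) = (\<Sum>j<k. g (Suc (k - Suc j)))"
    by (rule sum.nat_diff_reindex[symmetric])
  also have "\<dots> = (\<Sum>j<k. g (k - j))" by (rule sum.cong) (auto simp: Suc_diff_Suc)
  finally show ?thesis .
qed

text \<open>The discrete counterpart of integration over the slices. The index \<open>j\<close> is the distance \<open>k - \<bar>t\<bar>\<close>
  from the apex, hence the size of the slice.\<close>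
lemma lattice_sum_height_double_cone:
  fixes P :: "(real^'n) set" and \<phi> :: "real \<Rightarrow> real"
  defines "P0 \<equiv> convex hull (insert 0 P)"
  assumes P: "compact P" and k: "k \<ge> 1"
  shows "(\<Sum>x\<in>dilate k (double_cone P) \<inter> integer_points. \<phi> \<bar>x $ None\<bar>)
    = \<phi> 0 * real (lattice_count (dilate k P0))
      + 2 * (\<Sum>j<k. \<phi> (real (k - j)) * real (lattice_count (dilate j P0)))"
proof -
  let ?L = "\<lambda>j. dilate j P0 \<inter> integer_points"
  let ?X = "SIGMA t:{- int k..int k}. ?L (k - nat \<bar>t\<bar>)"
  have P0: "compact P0" unfolding P0_def using P by (intro compact_convex_hull) auto
  have fin: "finite (?L j)" for j
    by (intro finite_bounded_integer_points compact_imp_bounded compact_dilate P0)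
  have height: "real k - \<bar>real_of_int t\<bar> = real (k - nat \<bar>t\<bar>)" if "t \<in> {- int k..int k}" for t
    using that by (subst of_nat_diff) auto
  have mem: "append_coord p (real_of_int t) \<in> dilate k (double_cone P)
      \<longleftrightarrow> t \<in> {- int k..int k} \<and> p \<in> dilate (k - nat \<bar>t\<bar>) P0" for p t
  proof -
    have "\<bar>real_of_int t\<bar> \<le> real k \<longleftrightarrow> t \<in> {- int k..int k}" by auto
    then show ?thesis
      using append_coord_mem_dilate_double_cone[OF k, of p "real_of_int t" P] height[of t]
      unfolding P0_def[symmetric] dilate_def by auto
  qed
  have "(\<Sum>x\<in>dilate k (double_cone P) \<inter> integer_points. \<phi> \<bar>x $ None\<bar>)
      = (\<Sum>(t, p)\<in>?X. \<phi> (real (nat \<bar>t\<bar>)))"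
  proof (rule sum.reindex_bij_witness[where i = "\<lambda>(t, p). append_coord p (real_of_int t)"
        and j = "\<lambda>x. (\<lfloor>x $ None\<rfloor>, base_coords x)"])
    fix x assume x: "x \<in> dilate k (double_cone P) \<inter> integer_points"
    have int: "real_of_int \<lfloor>x $ None\<rfloor> = x $ None"
      using x by (auto simp: integer_points_def elim: Ints_cases)
    then have x_eq: "append_coord (base_coords x) (real_of_int \<lfloor>x $ None\<rfloor>) = x"
      using append_coord_base_coords[of x] by (simp only: int)
    then show "(case (\<lfloor>x $ None\<rfloor>, base_coords x) of (t, p) \<Rightarrow> append_coord p (real_of_int t)) = x" by simp
    show "(\<lfloor>x $ None\<rfloor>, base_coords x) \<in> ?X"
      using x mem[of "base_coords x" "\<lfloor>x $ None\<rfloor>"] append_coord_integer_points[of "base_coords x" "x $ None"]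
      unfolding x_eq by auto
    show "(case (\<lfloor>x $ None\<rfloor>, base_coords x) of (t, p) \<Rightarrow> \<phi> (real (nat \<bar>t\<bar>))) = \<phi> \<bar>x $ None\<bar>"
      by (simp add: int)
  next
    fix tp assume "tp \<in> ?X"
    then show "(case tp of (t, p) \<Rightarrow> append_coord p (real_of_int t)) \<in> dilate k (double_cone P) \<inter> integer_points"
      using mem by (auto simp: append_coord_integer_points)
    show "(\<lfloor>(case tp of (t, p) \<Rightarrow> append_coord p (real_of_int t)) $ None\<rfloor>,
        base_coords (case tp of (t, p) \<Rightarrow> append_coord p (real_of_int t))) = tp"
      by (cases tp) simp
  qed
  also have "\<dots> = (\<Sum>t\<in>{- int k..int k}. \<Sum>p\<in>?L (k - nat \<bar>t\<bar>). \<phi> (real (nat \<bar>t\<bar>)))"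
    by (rule sum.Sigma[symmetric]) (auto simp: fin)
  also have "\<dots> = (\<Sum>t\<in>{- int k..int k}. (\<lambda>s. \<phi> (real s) * real (lattice_count (dilate (k - s) P0))) (nat \<bar>t\<bar>))"
    by (simp add: lattice_count_def mult.commute)
  also have "\<dots> = \<phi> 0 * real (lattice_count (dilate k P0))
      + 2 * (\<Sum>j<k. \<phi> (real (k - j)) * real (lattice_count (dilate (k - (k - j)) P0)))"
    by (subst sum_symmetric_interval) simp
  also have "(\<Sum>j<k. \<phi> (real (k - j)) * real (lattice_count (dilate (k - (k - j)) P0)))
      = (\<Sum>j<k. \<phi> (real (k - j)) * real (lattice_count (dilate j P0)))"
    by (rule sum.cong) auto
  finally show ?thesis .
qed

section \<open>Instability of the double cone\<close>

theorem proposition3p7: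
  fixes P :: "(real ^ 'n) set"
  assumes "integral_polytope P"
    and "aff_dim P = int CARD('n)"
    and "Vol P \<ge> (real CARD('n) + 2) * (real CARD('n) + 1)"
  shows "\<not> asymptotically_Chow_semistable (double_cone P)"
proof
  assume stable: "asymptotically_Chow_semistable (double_cone P)"
  let ?n = "CARD('n)" and ?D = "double_cone P"
  define P0 where "P0 = convex hull (insert 0 P)"
  define v where "v = Vol P0"
  define b where "b j = real (lattice_count (dilate j P0))" for j
  define N where "N k = b k + 2 * (\<Sum>j<k. b j)" for k
  define W where "W k = 2 * v * real k ^ (?n + 1) / real (?n + 1)" for k :: nat
  have P: "compact P" using assms(1) by (auto simp: integral_polytope_def intro: finite_imp_compact_convex_hull)
  have P0: "compact P0" "convex P0" "P \<subseteq> P0"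
    unfolding P0_def using P hull_subset[of "insert 0 P" convex] by (auto intro: compact_convex_hull)
  have Vol_le: "Vol P \<le> v" unfolding v_def Vol_def
    using P0 P by (intro measure_mono_fmeasurable) (auto intro: lmeasurable_compact fmeasurableD)
  have "real (?n + 2) * real (?n + 1) = (real ?n + 2) * (real ?n + 1)" by (simp add: algebra_simps)
  then have v: "v \<ge> real (?n + 2) * real (?n + 1)" using assms(3) Vol_le by linarith
  moreover have "real (?n + 2) * real (?n + 1) > 0" by simp
  ultimately have v0: "v > 0" by linarith
  have D: "convex ?D" "compact ?D"
  proof -
    show "convex ?D" unfolding double_cone_def by (rule convex_convex_hull)
    obtain V where "finite V" "?D = convex hull V"
      using integral_polytope_double_cone[OF assms(1)] by (auto simp: integral_polytope_def)
    then show "compact ?D" by (simp add: finite_imp_compact_convex_hull)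
  qed
  have Vol_kD: "Vol (dilate k ?D) = W k" if "k \<ge> 1" for k
    using Vol_dilate_double_cone[OF P that] by (simp add: W_def v_def P0_def)
  have Vol_D: "Vol ?D = 2 * v / real (?n + 1)"
    using Vol_kD[of 1] by (simp add: W_def dilate_def)
  then have Vol_D_pos: "Vol ?D > 0" using v0 by simp
  have N_kD: "real (lattice_count (dilate k ?D)) = N k" if "k \<ge> 1" for k
    using lattice_sum_height_double_cone[OF P that, of "\<lambda>_. 1"]
    by (simp add: N_def b_def P0_def lattice_count_def)
  obtain C where C: "\<And>k f. k \<ge> C \<Longrightarrow> k \<ge> 1 \<Longrightarrow> convex_on UNIV f \<Longrightarrow>
      1 / Vol (dilate k ?D) * (LINT x:dilate k ?D|lebesgue. f x)
        \<le> 1 / real (lattice_count (dilate k ?D)) * (\<Sum>p\<in>dilate k ?D \<inter> integer_points. f p)"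
    using semistable_without_invariance[OF D(2) Vol_D_pos D(1) stable] by metis
  have b0: "b 0 = 1"
  proof -
    have "dilate 0 P0 = {0}" using P0_def hull_inc[of 0 "insert 0 P"] by (auto simp: dilate_def image_constant_conv)
    then show ?thesis by (simp add: b_def lattice_count_def integer_points_def)
  qed
  have N_pos: "N k > 0" if "k \<ge> 1" for k
  proof -
    have "b 0 \<le> (\<Sum>j<k. b j)" using that by (intro member_le_sum) (auto simp: b_def)
    moreover have "b k \<ge> 0" by (simp add: b_def)
    ultimately show ?thesis using b0 unfolding N_def by linarith
  qed
  show False
  proof (rule cap_inequalities_contradictory[of ?n v b C])
    show "?n \<ge> 1" by (simp add: Suc_leI)
    show "real (?n + 2) * real (?n + 1) \<le> v" by (rule v)
    show "b 0 = 1" by (rule b0)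
    show "b j \<ge> 0" for j by (simp add: b_def)
    show "\<forall>\<^sub>F k in sequentially. s * (v * real k ^ ?n) \<le> b k" if "s < 1" for s
      using lattice_count_dilate_eventually_ge[OF P0(2) compact_imp_bounded[OF P0(1)] _ that] v0
      by (simp add: v_def b_def)
    show "\<forall>\<^sub>F k in sequentially. s * (2 * v * real k ^ (?n + 1) / real (?n + 1)) \<le> b k + 2 * (\<Sum>j<k. b j)"
      if "s < 1" for s
      using lattice_count_dilate_eventually_ge[OF D(1) compact_imp_bounded[OF D(2)] Vol_D_pos that]
        eventually_ge_at_top[of 1]
      by eventually_elim (simp add: N_kD N_def[symmetric] Vol_D)
    show "(b k + 2 * (\<Sum>j<k. b j)) * (2 * v * real m ^ (?n + 2) / (real (?n + 1) * real (?n + 2)))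
        \<le> 2 * v * real k ^ (?n + 1) / real (?n + 1) * (2 * (\<Sum>j<m. real (m - j) * b j))"
      if km: "k \<ge> C" "1 \<le> m" "m \<le> k" for k m
    proof -
      have k: "k \<ge> 1" using km by simp
      \<comment> \<open>The cap of depth \<open>m\<close> around the two apexes.\<close>
      let ?\<phi> = "\<lambda>s. max 0 (s - real (k - m))"
      let ?f = "\<lambda>x::real^('n option). ?\<phi> \<bar>x $ None\<bar>"
      have "convex_on UNIV ?f"
      proof (rule convex_onI)
        fix t :: real and x y :: "real^('n option)"
        assume t: "0 < t" "t < 1"
        let ?z = "(1 - t) *\<^sub>R x + t *\<^sub>R y"
        have "\<bar>?z $ None\<bar> \<le> \<bar>(1 - t) * x $ None\<bar> + \<bar>t * y $ None\<bar>" by simp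
        also have "\<dots> = (1 - t) * \<bar>x $ None\<bar> + t * \<bar>y $ None\<bar>" using t by (simp add: abs_mult)
        finally have "\<bar>?z $ None\<bar> - real (k - m)
            \<le> (1 - t) * (\<bar>x $ None\<bar> - real (k - m)) + t * (\<bar>y $ None\<bar> - real (k - m))"
          by (simp add: algebra_simps)
        also have "\<dots> \<le> (1 - t) * ?f x + t * ?f y"
          using t by (intro add_mono mult_left_mono) auto
        finally show "?f ?z \<le> (1 - t) * ?f x + t * ?f y" using t by simp
      qed simp
      from C[OF km(1) k this]
      have ineq: "1 / W k * (LINT x:dilate k ?D|lebesgue. ?f x) \<le> 1 / N k * (\<Sum>p\<in>dilate k ?D \<inter> integer_points. ?f p)"
        using k by (simp add: Vol_kD N_kD)
      have "(\<Sum>p\<in>dilate k ?D \<inter> integer_points. ?f p)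
          = 2 * (\<Sum>j<k. max 0 (real (k - j) - real (k - m)) * b j)"
        using lattice_sum_height_double_cone[OF P k, of ?\<phi>] by (simp add: b_def P0_def)
      also have "(\<Sum>j<k. max 0 (real (k - j) - real (k - m)) * b j) = (\<Sum>j<m. real (m - j) * b j)"
        using km by (intro sum.mono_neutral_cong_right) (auto simp: of_nat_diff)
      finally have sum: "(\<Sum>p\<in>dilate k ?D \<inter> integer_points. ?f p) = 2 * (\<Sum>j<m. real (m - j) * b j)" .
      have "W k > 0" using v0 k by (simp add: W_def)
      then have "N k * (LINT x:dilate k ?D|lebesgue. ?f x) \<le> W k * (\<Sum>p\<in>dilate k ?D \<inter> integer_points. ?f p)"
        using ineq N_pos[OF k] by (simp add: field_simps)
      then show ?thesis
        unfolding integral_cap_double_cone[OF P k km(3)] sum by (simp add: N_def W_def v_def P0_def)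
    qed
  qed
qed


end
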